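(* Let $\mu\in\mathbb{R}$, $\sigma>0$ and $q<3$. The characteristic function of the Tsallis $q$-Gaussian distribution $\mathit{TQG}(\mu,\sigma,q)$ satisfies, for all $t\in\mathbb{R}$, $$\operatorname{cf}_{\mathit{TQG}(\mu,\sigma,q)}(t)=\exp(\mathrm{i}t\mu)\,\operatorname{cf}_{\mathit{TQG}(0,1,q)}(\sigma t),$$ where $\mathrm{i}=\sqrt{-1}$, and the characteristic function $\operatorname{cf}_{\mathit{TQG}(0,1,q)}$ of the standard Tsallis $q$-Gaussian distribution is given, for all $t\in\mathbb{R}$, as follows. (i) If $q<1$, then, with $a=\sqrt{\frac{2}{1-q}}$ and $\theta=\frac{2-q}{1-q}$, $$\operatorname{cf}_{\mathit{TQG}(0,1,q)}(t)={}_0F_1\!\left(\theta+\tfrac12,\,-\tfrac14(at)^2\right)=2^{\theta-\frac12}\,\Gamma\!\left(\theta+\tfrac12\right)(at)^{-(\theta-\frac12)}J_{\theta-\frac12}(at)=\operatorname{cf}_{\mathit{BetaSymmetric}(\theta)}(at).$$ (ii) If $q=1$, then $$\operatorname{cf}_{\mathit{TQG}(0,1,q)}(t)=\exp\!\left(-\frac{t^2}{2}\right)=\operatorname{cf}_{\mathit{Normal}(0,1)}(t).$$ (iii) If $1<q<3$, then, with $b=\sqrt{\frac{2}{3-q}}$ and $\nu=\frac{3-q}{q-1}>0$, $$\operatorname{cf}_{\mathit{TQG}(0,1,q)}(t)=\frac{\left(b\sqrt{\nu}\,|t|\right)^{\frac{\nu}{2}}K_{\frac{\nu}{2}}\!\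left(b\sqrt{\nu}\,|t|\right)}{2^{\frac{\nu}{2}-1}\,\Gamma\!\left(\frac{\nu}{2}\right)}=\operatorname{cf}_{\mathit{Student}(\nu)}(bt).$$
   Context: The characteristic function of a real random variable $X$ (or of its distribution) is $\operatorname{cf}_X(t)=\mathbb{E}[e^{\mathrm{i}tX}]$, $t\in\mathbb{R}$. For $\mu\in\mathbb{R}$ (location), $\sigma>0$ (scale) and $q<3$ (shape), the Tsallis $q$-Gaussian distribution $\mathit{TQG}(\mu,\sigma,q)$ is the probability distribution on $\mathbb{R}$ with density with respect to Lebesgue measure $$f(x)=C_{q,\sigma}\left[1-(1-q)\frac12\left(\frac{x-\mu}{\sigma}\right)^2\right]_+^{\frac{1}{1-q}}\qquad(q\neq1),$$ where $[z]_+=\max(0,z)$ and $C_{q,\sigma}>0$ is the normalizing constant. For $q=1$, $\mathit{TQG}(\mu,\sigma,1)$ is the normal distribution $N(\mu,\sigma^2)$ with mean $\mu$ and variance $\sigma^2$. $\mathit{BetaSymmetric}(\theta)$, $\theta>0$, is the symmetric beta distribution supported on $[-1,1]$, i.e. the law of $2B-1$ with $B\sim\mathit{Beta}(\theta,\theta)$; $\mathit{Normal}(0,1)$ is the standard normal distribution; $\mathit{Student}(\nu)$ is the Student $t$-distribution with $\nu>0$ (not necessarily integer) degrees of freedom. ${}_0F_1(b,z)=\sum_{k\ge0}\frac{\Gamma(b)}{\Gamma(b+k)}\frac{z^k}{k!}$ is the confluent hypergeometric (limit) function, $\Gamma$ is the gamma function, $J_\alpha$ is the Bessel function of the first kind,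 and $K_\alpha$ is the modified Bessel function of the second kind. Conventions: $z^{-\alpha}J_\alpha(z)$ denotes the even entire function $2^{-\alpha}\sum_{k\ge0}\frac{(-1)^k}{k!\,\Gamma(\alpha+k+1)}\left(\frac z2\right)^{2k}$, so that the expression is defined for all real $t$ including $t\le 0$; the Bessel-$K$ expression in case (iii) is understood at $t=0$ by its limit as $t\to0$, which is $1$. *)

theory Defs
  imports "HOL-Probability.Probability" "HOL-Real_Asymp.Real_Asymp"
begin

definition tqg_kernel :: "real \<Rightarrow> real \<Rightarrow> real \<Rightarrow> real \<Rightarrow> real" where
  "tqg_kernel \<mu> \<sigma> q x = (max 0 (1 - (1 - q) * (1 / 2) * ((x - \<mu>) / \<sigma>)\<^sup>2)) powr (1 / (1 - q))"

text \<open>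
  For \<open>q < 1\<close> the exponent is positive and \<open>0 powr _ = 0\<close> makes the kernel vanish off its support;
  for \<open>q > 1\<close> the base is at least 1. The normalizing constant is the reciprocal of the Lebesgue
  integral of the kernel.
\<close>

definition tqg_density :: "real \<Rightarrow> real \<Rightarrow> real \<Rightarrow> real \<Rightarrow> real" where
  "tqg_density \<mu> \<sigma> q x =
     (if q = 1 then normal_density \<mu> \<sigma> x
      else tqg_kernel \<mu> \<sigma> q x / (LBINT y. tqg_kernel \<mu> \<sigma> q y))"

definition TQG :: "real \<Rightarrow> real \<Rightarrow> real \<Rightarrow> real measure" where
  "TQG \<mu> \<sigma> q = density lborel (\<lambda>x. ennreal (tqg_density \<mu> \<sigma> q x))"

definition beta_distribution :: "real \<Rightarrow> real \<Rightarrow> real measure" where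
  "beta_distribution a b = density lborel
     (\<lambda>x. ennreal (indicator {0<..<1} x * (x powr (a - 1) * (1 - x) powr (b - 1) / Beta a b)))"

definition BetaSymmetric :: "real \<Rightarrow> real measure" where
  "BetaSymmetric \<theta> = distr (beta_distribution \<theta> \<theta>) borel (\<lambda>x. 2 * x - 1)"

definition Student :: "real \<Rightarrow> real measure" where
  "Student \<nu> = density lborel
     (\<lambda>x. ennreal (Gamma ((\<nu> + 1) / 2) / (sqrt (\<nu> * pi) * Gamma (\<nu> / 2))
            * (1 + x\<^sup>2 / \<nu>) powr (- (\<nu> + 1) / 2)))"

definition hyp0F1 :: "real \<Rightarrow> real \<Rightarrow> real" where
  "hyp0F1 b z = (\<Sum>k. Gamma b / Gamma (b + real k) * (z ^ k / fact k))"

text \<open>Bessel function of the first kind, for positive real argument.\<close>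

definition Bessel_J :: "real \<Rightarrow> real \<Rightarrow> real" where
  "Bessel_J \<alpha> z =
     (\<Sum>k. (-1) ^ k / (fact k * Gamma (\<alpha> + real k + 1)) * (z / 2) powr (2 * real k + \<alpha>))"

text \<open>
  The even entire function denoted by \<open>z powr (-\<alpha>) * Bessel_J \<alpha> z\<close>: the product itself is only
  meaningful for positive \<open>z\<close>, where the two agree by \<open>Bessel_J_scaled_eq\<close>.
\<close>

definition Bessel_J_scaled :: "real \<Rightarrow> real \<Rightarrow> real" where
  "Bessel_J_scaled \<alpha> z =
     2 powr (-\<alpha>) * (\<Sum>k. (-1) ^ k / (fact k * Gamma (\<alpha> + real k + 1)) * (z / 2) ^ (2 * k))"

lemma Bessel_J_scaled_eq:
  assumes "z > 0"
  shows "z powr (-\<alpha>) * Bessel_J \<alpha> z = Bessel_J_scaled \<alpha> z"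
proof -
  define c where "c = (\<lambda>k. (-1) ^ k / (fact k * Gamma (\<alpha> + real k + 1)) * (z / 2) ^ (2 * k))"
  have pw: "(z / 2) powr (2 * real k + \<alpha>) = (z / 2) powr \<alpha> * (z / 2) ^ (2 * k)" for k
    using assms by (simp add: powr_add flip: powr_realpow)
  have "Bessel_J \<alpha> z = (\<Sum>k. (z / 2) powr \<alpha> * c k)"
    unfolding Bessel_J_def c_def pw by (simp add: mult_ac)
  also have "\<dots> = (z / 2) powr \<alpha> * (\<Sum>k. c k)"
  proof (rule suminf_mult)
    obtain N :: nat where N: "\<bar>\<alpha>\<bar> + 2 * (z / 2)\<^sup>2 \<le> real N"
      using real_arch_simple by blast
    show "summable c"
    proof (rule summable_ratio_test)
      fix n assume n: "n \<ge> N"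
      then have nN: "real n \<ge> real N" by simp
      define x where "x = \<alpha> + real n + 1"
      define w where "w = (z / 2)\<^sup>2"
      have w: "w \<ge> 0" by (simp add: w_def)
      have x: "x \<ge> 1"
        using N nN w unfolding x_def w_def by linarith
      have g: "Gamma (\<alpha> + real (Suc n) + 1) = x * Gamma x"
        using Gamma_plus1[of x] x by (auto simp: x_def add_ac nonpos_Ints_def)
      have pos: "Gamma x > 0"
        using x by (intro Gamma_real_pos) auto
      have cn: "c n = (-1) ^ n / (fact n * Gamma x) * (z / 2) ^ (2 * n)"
        by (simp add: c_def x_def)
      have "c (Suc n) = (-1) ^ Suc n / (fact (Suc n) * (x * Gamma x)) * (z / 2) ^ (2 * Suc n)"
        unfolding c_def g ..
      also have "\<dots> = - (w / (real (Suc n) * x)) * c n"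
        using pos x by (simp add: cn w_def power2_eq_square mult_ac del: of_nat_Suc)
      finally have cS: "c (Suc n) = - (w / (real (Suc n) * x)) * c n" .
      have "2 * w \<le> real (Suc n) * 1"
        using N nN unfolding w_def of_nat_Suc mult_1_right by linarith
      also have "\<dots> \<le> real (Suc n) * x"
        using x by (intro mult_left_mono) auto
      finally have "w / (real (Suc n) * x) \<le> 1 / 2"
        using x by (subst pos_divide_le_eq) auto
      then have "w / (real (Suc n) * x) * \<bar>c n\<bar> \<le> 1 / 2 * \<bar>c n\<bar>"
        by (rule mult_right_mono) simp
      then show "norm (c (Suc n)) \<le> 1 / 2 * norm (c n)"
        unfolding cS using w x by (simp add: abs_mult del: of_nat_Suc)
    qed simp
  qed
  finally show ?thesis
    using assms by (simp add: Bessel_J_scaled_def c_def powr_divide powr_minus field_simps)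
qed

text \<open>
  Modified Bessel function of the second kind, for positive real argument, by its classical integral
  \<open>\<integral>\<^sub>0\<^sup>\<infinity> exp (- z * cosh u) * cosh (\<alpha> * u) du\<close>. The lemmas \<open>Bessel_K_ode\<close> and
  \<open>Bessel_K_asymp\<close> show that it is the standard one: the solution of the modified Bessel equation
  of order \<open>\<alpha>\<close> that is asymptotic to \<open>sqrt (pi / (2 * z)) * exp (- z)\<close> at infinity.
\<close>

definition Bessel_K :: "real \<Rightarrow> real \<Rightarrow> real" where
  "Bessel_K \<alpha> z = (LBINT u:{0<..}. exp (- z * cosh u) * cosh (\<alpha> * u))"

definition Bessel_K_integrand :: "real \<Rightarrow> nat \<Rightarrow> real \<Rightarrow> real \<Rightarrow> real" where
  "Bessel_K_integrand \<alpha> k z u = indicator {0<..} u * (exp (- z * cosh u) * cosh u ^ k * cosh (\<alpha> * u))"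

lemma power_times_exp_minus_le_fact: "x ^ n * exp (-x) \<le> fact n" if "x \<ge> 0" for x :: real
proof -
  have "(\<Sum>i\<in>{n}. x ^ i /\<^sub>R fact i) \<le> (\<Sum>i. x ^ i /\<^sub>R fact i)"
    by (rule sum_le_suminf[OF summable_exp_generic]) (use that in auto)
  then have "x ^ n / fact n \<le> exp x" by (simp add: exp_def divide_inverse mult.commute)
  then show ?thesis by (simp add: exp_minus field_simps)
qed

lemma Bessel_K_integrand_bound:
  assumes "z > 0"
  shows "\<exists>C. \<forall>u. \<bar>Bessel_K_integrand \<alpha> k z u\<bar> \<le> C * (indicator {0<..} u * exp (-u))"
proof -
  obtain m :: nat where m: "\<bar>\<alpha>\<bar> \<le> real m" using real_arch_simple by blast
  define n where "n = k + m + 1"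
  show ?thesis
  proof (intro exI allI)
    fix u
    show "\<bar>Bessel_K_integrand \<alpha> k z u\<bar> \<le> (fact n * 2 ^ (m+1) / z ^ n) * (indicator {0<..} u * exp (-u))"
    proof (cases "u > 0")
      case True
      define c where "c = cosh u"
      have c: "c > 0" "exp u \<le> 2 * c" by (simp_all add: c_def cosh_real_pos) (simp add: cosh_def)
      have "cosh (\<alpha> * u) \<le> exp (\<bar>\<alpha>\<bar> * u)"
      proof -
        have "cosh (\<alpha> * u) = cosh (\<bar>\<alpha>\<bar> * u)" by (cases "\<alpha> \<ge> 0") auto
        also have "\<dots> \<le> exp (\<bar>\<alpha>\<bar> * u)" using True by (simp add: cosh_def)
        finally show ?thesis .
      qed
      also have "\<dots> \<le> exp (real m * u)" using True m by simp
      also have "\<dots> = exp u ^ m" by (simp add: exp_of_nat_mult)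
      also have "\<dots> \<le> (2 * c) ^ m" using c by (intro power_mono) auto
      finally have A: "cosh (\<alpha> * u) \<le> (2 * c) ^ m" .
      have "exp (- z * c) \<le> fact n / (z * c) ^ n"
        using power_times_exp_minus_le_fact[of "z * c" n] assms c by (simp add: field_simps)
      then have "exp (- z * c) * c ^ k * cosh (\<alpha> * u) \<le> fact n / (z * c) ^ n * c ^ k * (2 * c) ^ m"
        using A c assms by (intro mult_mono) auto
      also have "\<dots> = fact n * 2 ^ m / z ^ n * (1 / c)"
        using c assms by (simp add: n_def field_simps power_add power_mult_distrib)
      also have "\<dots> \<le> fact n * 2 ^ m / z ^ n * (2 * exp (-u))"
        using c assms by (intro mult_left_mono) (auto simp: exp_minus field_simps)
      finally show ?thesis using True by (simp add: Bessel_K_integrand_def c_def mult_ac)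
    qed (simp add: Bessel_K_integrand_def)
  qed
qed

lemma integrable_exp_minus: "integrable lborel (\<lambda>u::real. indicator {0<..} u * exp (-u))"
proof -
  interpret prob_space "density lborel (exponential_density 1)" by (rule prob_space_exponential_density) simp
  have "integrable (density lborel (exponential_density 1)) (\<lambda>_. 1::real)" by simp
  then have *: "integrable lborel (exponential_density 1)"
    by (subst (asm) integrable_density) (auto simp: exponential_density_def[abs_def])
  show ?thesis by (rule Bochner_Integration.integrable_bound[OF *]) (auto simp: exponential_density_def indicator_def)
qed

lemma Bessel_K_integrand_meas [measurable]: "Bessel_K_integrand \<alpha> k z \<in> borel_measurable borel"
proof -
  have "continuous_on UNIV (\<lambda>u::real. (exp (- z * cosh u) * cosh u ^ k * cosh (\<alpha> * u)))"
    by (intro continuous_intros)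
  from borel_measurable_continuous_onI[OF this] show ?thesis unfolding Bessel_K_integrand_def by measurable
qed

lemma Bessel_K_integrand_int: assumes "z > 0" shows "integrable lborel (Bessel_K_integrand \<alpha> k z)"
proof -
  obtain C where "\<forall>u. \<bar>Bessel_K_integrand \<alpha> k z u\<bar> \<le> C * (indicator {0<..} u * exp (-u))" using Bessel_K_integrand_bound[OF assms] by blast
  then show ?thesis
    by (intro Bochner_Integration.integrable_bound[OF integrable_mult_right[OF integrable_exp_minus, of C]])
       (auto intro!: AE_I2 order_trans[OF _ abs_ge_self])
qed

lemma Bessel_K_integrand_deriv:
  assumes "z > 0"
  shows "((\<lambda>z. LBINT u. Bessel_K_integrand \<alpha> k z u) has_real_derivative - (LBINT u. Bessel_K_integrand \<alpha> (Suc k) z u)) (at z)"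
  unfolding has_field_derivative_iff
proof (subst tendsto_at_iff_sequentially, intro allI impI)
  fix X :: "nat \<Rightarrow> real" assume X: "\<forall>i. X i \<in> UNIV - {z}" "X \<longlonglongrightarrow> z"
  have ev: "eventually (\<lambda>i. X i > z / 2) sequentially"
    using X(2) assms by (intro order_tendstoD) auto
  then obtain N where N: "\<And>i. i \<ge> N \<Longrightarrow> X i > z / 2" by (auto simp: eventually_sequentially)
  have nz: "X i \<noteq> z" for i using X(1) by auto
  have L: "(\<lambda>i. LBINT u. (Bessel_K_integrand \<alpha> k (X (i + N)) u - Bessel_K_integrand \<alpha> k z u) / (X (i + N) - z)) \<longlonglongrightarrow> (LBINT u. - Bessel_K_integrand \<alpha> (Suc k) z u)"
  proof (rule integral_dominated_convergence)
    show "integrable lborel (Bessel_K_integrand \<alpha> (Suc k) (z/2))" using assms by (intro Bessel_K_integrand_int) auto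
    show "AE u in lborel. (\<lambda>i. (Bessel_K_integrand \<alpha> k (X (i + N)) u - Bessel_K_integrand \<alpha> k z u) / (X (i + N) - z)) \<longlonglongrightarrow> - Bessel_K_integrand \<alpha> (Suc k) z u"
    proof (rule AE_I2)
      fix u
      have "((\<lambda>z. Bessel_K_integrand \<alpha> k z u) has_real_derivative - Bessel_K_integrand \<alpha> (Suc k) z u) (at z)"
        unfolding Bessel_K_integrand_def by (auto intro!: derivative_eq_intros simp: mult_ac)
      then have "(\<lambda>i. (Bessel_K_integrand \<alpha> k (X i) u - Bessel_K_integrand \<alpha> k z u) / (X i - z)) \<longlonglongrightarrow> - Bessel_K_integrand \<alpha> (Suc k) z u"
        unfolding has_field_derivative_iff tendsto_at_iff_sequentially using X by (auto simp: o_def)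
      then show "(\<lambda>i. (Bessel_K_integrand \<alpha> k (X (i + N)) u - Bessel_K_integrand \<alpha> k z u) / (X (i + N) - z)) \<longlonglongrightarrow> - Bessel_K_integrand \<alpha> (Suc k) z u"
        by (rule LIMSEQ_ignore_initial_segment)
    qed
    show "AE u in lborel. norm ((Bessel_K_integrand \<alpha> k (X (i + N)) u - Bessel_K_integrand \<alpha> k z u) / (X (i + N) - z)) \<le> Bessel_K_integrand \<alpha> (Suc k) (z/2) u" for i
    proof (rule AE_I2)
      fix u
      define y where "y = X (i + N)"
      have y: "y > z / 2" "y \<noteq> z" using N nz by (auto simp: y_def)
      have D: "((\<lambda>z. Bessel_K_integrand \<alpha> k z u) has_real_derivative - Bessel_K_integrand \<alpha> (Suc k) w u) (at w within S)" for w S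
        unfolding Bessel_K_integrand_def by (auto intro!: derivative_eq_intros simp: mult_ac)
      have "norm (Bessel_K_integrand \<alpha> k y u - Bessel_K_integrand \<alpha> k z u) \<le> Bessel_K_integrand \<alpha> (Suc k) (z/2) u * norm (y - z)"
      proof (rule field_differentiable_bound[where S = "{z/2..}", OF _ D])
        fix w assume w: "w \<in> {z/2..}"
        have "norm (- Bessel_K_integrand \<alpha> (Suc k) w u) = Bessel_K_integrand \<alpha> (Suc k) w u"
          by (auto simp: Bessel_K_integrand_def cosh_real_nonneg intro!: mult_nonneg_nonneg)
        also have "\<dots> \<le> Bessel_K_integrand \<alpha> (Suc k) (z/2) u"
          unfolding Bessel_K_integrand_def using w assms
          by (intro mult_left_mono mult_right_mono) (auto simp: cosh_real_nonneg mult_right_mono)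
        finally show "norm (- Bessel_K_integrand \<alpha> (Suc k) w u) \<le> Bessel_K_integrand \<alpha> (Suc k) (z/2) u" .
      qed (use y assms in auto)
      then show "norm ((Bessel_K_integrand \<alpha> k (X (i + N)) u - Bessel_K_integrand \<alpha> k z u) / (X (i + N) - z)) \<le> Bessel_K_integrand \<alpha> (Suc k) (z/2) u"
        using y unfolding y_def[symmetric] by (simp add: field_simps)
    qed
  qed auto
  have E: "(LBINT u. (Bessel_K_integrand \<alpha> k (X (i + N)) u - Bessel_K_integrand \<alpha> k z u) / (X (i + N) - z)) =
     ((LBINT u. Bessel_K_integrand \<alpha> k (X (i + N)) u) - (LBINT u. Bessel_K_integrand \<alpha> k z u)) / (X (i + N) - z)" for i
    using N[of "i + N"] assms by (simp add: Bessel_K_integrand_int)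
  have M: "(LBINT u. - Bessel_K_integrand \<alpha> (Suc k) z u) = - (LBINT u. Bessel_K_integrand \<alpha> (Suc k) z u)"
    by simp
  have "(\<lambda>i. ((LBINT u. Bessel_K_integrand \<alpha> k (X (i + N)) u) - (LBINT u. Bessel_K_integrand \<alpha> k z u)) / (X (i + N) - z)) \<longlonglongrightarrow> - (LBINT u. Bessel_K_integrand \<alpha> (Suc k) z u)"
    using L unfolding E M by -
  then show "((\<lambda>y. ((LBINT u. Bessel_K_integrand \<alpha> k y u) - (LBINT u. Bessel_K_integrand \<alpha> k z u)) / (y - z)) \<circ> X) \<longlonglongrightarrow> - (LBINT u. Bessel_K_integrand \<alpha> (Suc k) z u)"
    unfolding o_def by (rule LIMSEQ_offset)
qed

lemma Bessel_K_eq_integrand: "Bessel_K \<alpha> z = (LBINT u. Bessel_K_integrand \<alpha> 0 z u)"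
  by (simp add: Bessel_K_def set_lebesgue_integral_def Bessel_K_integrand_def)

lemma Bessel_K_integrand_decay:
  fixes \<alpha> z :: real
  assumes "z > 0"
  shows "((\<lambda>u. exp (- z * cosh u) * cosh u ^ k * cosh (\<alpha> * u)) \<longlongrightarrow> 0) at_top"
proof -
  obtain C where C: "\<forall>u. \<bar>Bessel_K_integrand \<alpha> k z u\<bar> \<le> C * (indicator {0<..} u * exp (-u))" using Bessel_K_integrand_bound[OF assms] by blast
  show ?thesis
  proof (rule Lim_null_comparison)
    show "eventually (\<lambda>u. norm (exp (- z * cosh u) * cosh u ^ k * cosh (\<alpha> * u)) \<le> C * exp (-u)) at_top"
      using eventually_gt_at_top[of 0]
    proof eventually_elim
      case (elim u) then show ?case using C[rule_format, of u] by (simp add: Bessel_K_integrand_def)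
    qed
    show "((\<lambda>u. C * exp (-u)) \<longlongrightarrow> 0) at_top"
      by (intro tendsto_mult_right_zero filterlim_compose[OF exp_at_bot filterlim_uminus_at_bot_at_top])
  qed
qed

lemma Bessel_K_integrand_ode:
  assumes z: "z > 0"
  shows "z\<^sup>2 * (LBINT u. Bessel_K_integrand \<alpha> 2 z u) - z * (LBINT u. Bessel_K_integrand \<alpha> 1 z u) - (z\<^sup>2 + \<alpha>\<^sup>2) * (LBINT u. Bessel_K_integrand \<alpha> 0 z u) = 0"
proof -
  define F where "F = (\<lambda>u. - exp (- z * cosh u) * (z * sinh u * cosh (\<alpha> * u) + \<alpha> * sinh (\<alpha> * u)))"
  define f where "f = (\<lambda>u. exp (- z * cosh u) * cosh (\<alpha> * u) * (z\<^sup>2 * cosh u ^ 2 - z * cosh u - (z\<^sup>2 + \<alpha>\<^sup>2)))"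
  have f_integrand: "(\<lambda>u. indicator {0<..} u *\<^sub>R f u) = (\<lambda>u. z\<^sup>2 * Bessel_K_integrand \<alpha> 2 z u - z * Bessel_K_integrand \<alpha> 1 z u - (z\<^sup>2 + \<alpha>\<^sup>2) * Bessel_K_integrand \<alpha> 0 z u)"
    by (auto simp: f_def Bessel_K_integrand_def fun_eq_iff algebra_simps indicator_def)
  have int: "integrable lborel (\<lambda>u. indicator {0<..} u *\<^sub>R f u)"
    unfolding f_integrand using z by (intro Bochner_Integration.integrable_diff integrable_mult_right Bessel_K_integrand_int)
  have ei: "einterval 0 \<infinity> = {0<..}" by (auto simp: einterval_def)
  have "(LBINT u=0..\<infinity>. f u) = 0 - 0"
  proof (rule interval_integral_FTC_integrable[where F = F])
    have cc: "cosh u * cosh u = 1 + sinh u * sinh u" for u :: real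
      using cosh_square_eq[of u] by (simp add: power2_eq_square)
    show "(F has_vector_derivative f u) (at u)" for u
      unfolding F_def f_def has_real_derivative_iff_has_vector_derivative[symmetric]
      by (rule derivative_eq_intros refl | simp)+
         (simp add: power2_eq_square cc, simp add: algebra_simps)
    show "isCont f u" for u unfolding f_def by (intro continuous_intros)
    show "set_integrable lborel (einterval 0 \<infinity>) f" using int by (simp add: ei set_integrable_def)
    have "isCont F 0" unfolding F_def by (intro continuous_intros)
    then have "(F \<longlongrightarrow> 0) (at_right 0)" by (auto simp: isCont_def F_def filterlim_at_split)
    then show "((F \<circ> real_of_ereal) \<longlongrightarrow> 0) (at_right 0)"
      using ereal_tendsto_simps(2)[of F 0 0] by (simp add: zero_ereal_def)
    have "(F \<longlongrightarrow> 0) at_top"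
    proof (rule Lim_null_comparison)
      show "eventually (\<lambda>u. norm (F u) \<le> z * (exp (- z * cosh u) * cosh u ^ 1 * cosh (\<alpha> * u)) + \<bar>\<alpha>\<bar> * (exp (- z * cosh u) * cosh u ^ 0 * cosh (\<alpha> * u))) at_top"
      proof (rule always_eventually, rule allI)
        fix u
        have s: "\<bar>sinh x\<bar> \<le> cosh x" for x :: real
          unfolding abs_le_iff sinh_field_def cosh_field_def by (simp add: field_simps)
        have "\<bar>z * sinh u * cosh (\<alpha> * u) + \<alpha> * sinh (\<alpha> * u)\<bar> \<le> \<bar>z * sinh u * cosh (\<alpha> * u)\<bar> + \<bar>\<alpha> * sinh (\<alpha> * u)\<bar>"
          by (rule abs_triangle_ineq)
        also have "\<dots> \<le> z * cosh u * cosh (\<alpha> * u) + \<bar>\<alpha>\<bar> * cosh (\<alpha> * u)"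
          using z s[of u] s[of "\<alpha> * u"] by (auto simp: abs_mult cosh_real_nonneg intro!: add_mono mult_mono)
        finally have le: "\<bar>z * sinh u * cosh (\<alpha> * u) + \<alpha> * sinh (\<alpha> * u)\<bar> \<le> z * cosh u * cosh (\<alpha> * u) + \<bar>\<alpha>\<bar> * cosh (\<alpha> * u)" .
        have FE: "norm (F u) = exp (- z * cosh u) * \<bar>z * sinh u * cosh (\<alpha> * u) + \<alpha> * sinh (\<alpha> * u)\<bar>"
          unfolding F_def real_norm_def abs_mult abs_minus_cancel by simp
        from le have "exp (- z * cosh u) * \<bar>z * sinh u * cosh (\<alpha> * u) + \<alpha> * sinh (\<alpha> * u)\<bar> \<le> exp (- z * cosh u) * (z * cosh u * cosh (\<alpha> * u) + \<bar>\<alpha>\<bar> * cosh (\<alpha> * u))"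
          by (rule mult_left_mono) simp
        then show "norm (F u) \<le> z * (exp (- z * cosh u) * cosh u ^ 1 * cosh (\<alpha> * u)) + \<bar>\<alpha>\<bar> * (exp (- z * cosh u) * cosh u ^ 0 * cosh (\<alpha> * u))"
          unfolding FE by (simp add: algebra_simps)
      qed
      show "((\<lambda>u. z * (exp (- z * cosh u) * cosh u ^ 1 * cosh (\<alpha> * u)) + \<bar>\<alpha>\<bar> * (exp (- z * cosh u) * cosh u ^ 0 * cosh (\<alpha> * u))) \<longlongrightarrow> 0) at_top"
        by (intro tendsto_add_zero tendsto_mult_right_zero Bessel_K_integrand_decay z)
    qed
    then show "((F \<circ> real_of_ereal) \<longlongrightarrow> 0) (at_left \<infinity>)"
      by (simp add: ereal_tendsto_simps)
  qed auto
  then have "(LBINT u. indicator {0<..} u *\<^sub>R f u) = 0"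
    by (simp add: interval_lebesgue_integral_def ei set_lebesgue_integral_def)
  then show ?thesis unfolding f_integrand using z by (simp add: Bessel_K_integrand_int)
qed

lemma Bessel_K_ode:
  "\<exists>K' K''. \<forall>z>0. (Bessel_K \<alpha> has_real_derivative K' z) (at z)
     \<and> (K' has_real_derivative K'' z) (at z)
     \<and> z\<^sup>2 * K'' z + z * K' z - (z\<^sup>2 + \<alpha>\<^sup>2) * Bessel_K \<alpha> z = 0"
proof (intro exI conjI allI impI)
  fix z :: real
  assume z: "z > 0"
  show "(Bessel_K \<alpha> has_real_derivative - (LBINT u. Bessel_K_integrand \<alpha> 1 z u)) (at z)"
    using Bessel_K_integrand_deriv[OF z, of \<alpha> 0] by (simp add: Bessel_K_eq_integrand[abs_def])
  show "((\<lambda>x. - (LBINT u. Bessel_K_integrand \<alpha> 1 x u)) has_real_derivative (LBINT u. Bessel_K_integrand \<alpha> 2 z u)) (at z)"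
    using DERIV_minus[OF Bessel_K_integrand_deriv[OF z, of \<alpha> 1]] by (simp add: numeral_2_eq_2)
  show "z\<^sup>2 * (LBINT u. Bessel_K_integrand \<alpha> 2 z u) + z * - (LBINT u. Bessel_K_integrand \<alpha> 1 z u)
      - (z\<^sup>2 + \<alpha>\<^sup>2) * Bessel_K \<alpha> z = 0"
    using Bessel_K_integrand_ode[OF z, of \<alpha>] by (simp add: Bessel_K_eq_integrand)
qed

lemma cosh_ge_quadratic: "cosh x \<ge> 1 + x\<^sup>2 / 2" for x :: real
proof -
  have "cosh x = 1 + 2 * sinh (x / 2) ^ 2" using cosh_square_eq[of "x/2"] cosh_add[of "x/2" "x/2"] by (simp add: power2_eq_square)
  moreover have sx: "y \<le> sinh y" if "y \<ge> 0" for y :: real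
  proof -
    have "sinh 0 - 0 \<le> sinh y - y"
      by (rule DERIV_nonneg_imp_nondecreasing[OF that])
         (auto intro!: exI derivative_eq_intros cosh_real_ge_1)
    then show ?thesis by simp
  qed
  have "\<bar>x/2\<bar> \<le> \<bar>sinh (x/2)\<bar>"
    using sx[of "\<bar>x/2\<bar>"] by (cases "x \<ge> 0") auto
  then have "(x/2)^2 \<le> sinh (x/2) ^ 2" by (simp only: abs_le_square_iff)
  ultimately show ?thesis by (simp add: power_divide)
qed

lemma Bessel_K_asymp:
  "((\<lambda>z. sqrt (2 * z / pi) * exp z * Bessel_K \<alpha> z) \<longlongrightarrow> 1) at_top"
proof -
  define s where "s = (\<lambda>z v. indicator {0<..} v * (exp (- z * (cosh (v / sqrt z) - 1)) * cosh (\<alpha> * (v / sqrt z))) :: real)"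
  have sub: "(LBINT v. s z v) = sqrt z * exp z * Bessel_K \<alpha> z" if "z > 0" for z
  proof -
    have "(LBINT u. Bessel_K_integrand \<alpha> 0 z u) = \<bar>1 / sqrt z\<bar> *\<^sub>R (LBINT v. Bessel_K_integrand \<alpha> 0 z (0 + 1 / sqrt z * v))"
      using that by (intro lborel_integral_real_affine) simp
    also have "(\<lambda>v. Bessel_K_integrand \<alpha> 0 z (0 + 1 / sqrt z * v)) = (\<lambda>v. exp (- z) * s z v)"
      using that by (auto simp: Bessel_K_integrand_def s_def fun_eq_iff indicator_def zero_less_mult_iff zero_less_divide_iff right_diff_distrib exp_diff exp_minus field_simps)
    finally show ?thesis using that by (simp add: Bessel_K_eq_integrand exp_minus field_simps)
  qed
  have "((\<lambda>z. LBINT v. s z v) \<longlongrightarrow> (LBINT v. indicator {0<..} v * exp (- v\<^sup>2 / 2))) at_top"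
  proof (rule integral_dominated_convergence_at_top)
    define w where "w = (\<lambda>v. sqrt (2 * pi) * exp (\<alpha>\<^sup>2 / 2) * (normal_density \<bar>\<alpha>\<bar> 1 v) :: real)"
    show "integrable lborel w" unfolding w_def by (intro integrable_mult_right integrable_normal_density) simp
    show "eventually (\<lambda>z. AE v in lborel. norm (s z v) \<le> w v) at_top"
      using eventually_ge_at_top[of 1]
    proof eventually_elim
      case (elim z)
      show ?case
      proof (rule AE_I2)
        fix v :: real
        show "norm (s z v) \<le> w v"
        proof (cases "v > 0")
          case True
          have "z * (cosh (v / sqrt z) - 1) \<ge> z * ((v / sqrt z)\<^sup>2 / 2)"
            using elim cosh_ge_quadratic[of "v / sqrt z"] by (intro mult_left_mono) auto
          then have 1: "exp (- z * (cosh (v / sqrt z) - 1)) \<le> exp (- v\<^sup>2 / 2)"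
            using elim by (simp add: power_divide)
          have "\<bar>\<alpha>\<bar> * (v / sqrt z) \<le> \<bar>\<alpha>\<bar> * v"
            using elim True by (intro mult_left_mono) (auto simp: field_simps)
          moreover have "cosh (\<alpha> * (v / sqrt z)) = cosh (\<bar>\<alpha>\<bar> * (v / sqrt z))"
            by (cases "\<alpha> \<ge> 0") auto
          moreover have "cosh x \<le> exp x" if "x \<ge> 0" for x :: real using that by (simp add: cosh_def)
          moreover have "\<bar>\<alpha>\<bar> * (v / sqrt z) \<ge> 0"
            using True elim by simp
          ultimately have 2: "cosh (\<alpha> * (v / sqrt z)) \<le> exp (\<bar>\<alpha>\<bar> * v)"
            by (metis exp_le_cancel_iff order_trans)
          have "exp (- z * (cosh (v / sqrt z) - 1)) * cosh (\<alpha> * (v / sqrt z)) \<le> exp (- v\<^sup>2 / 2) * exp (\<bar>\<alpha>\<bar> * v)"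
            using 1 2 by (intro mult_mono) auto
          also have "\<dots> = exp (\<alpha>\<^sup>2 / 2) * exp (- (v - \<bar>\<alpha>\<bar>)\<^sup>2 / 2)"
            unfolding exp_add[symmetric] by (simp add: power2_diff field_simps)
          also have "\<dots> = w v" by (simp add: w_def normal_density_def)
          finally show ?thesis using True by (simp add: s_def)
        qed (simp add: s_def w_def)
      qed
    qed
    show "AE v in lborel. ((\<lambda>z. s z v) \<longlongrightarrow> indicator {0<..} v * exp (- v\<^sup>2 / 2)) at_top"
    proof (rule AE_I2)
      fix v :: real
      show "((\<lambda>z. s z v) \<longlongrightarrow> indicator {0<..} v * exp (- v\<^sup>2 / 2)) at_top"
      proof (cases "v > 0")
        case True
        have "((\<lambda>z. exp (- z * (cosh (v / sqrt z) - 1)) * cosh (\<alpha> * (v / sqrt z))) \<longlongrightarrow> exp (- v\<^sup>2 / 2)) at_top"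
        proof -
          have "((\<lambda>z. exp (- z * (cosh (v / sqrt z) - 1))) \<longlongrightarrow> exp (- (v * v / 2))) at_top"
            using True unfolding cosh_field_def by real_asymp
          then have "((\<lambda>z. exp (- z * (cosh (v / sqrt z) - 1))) \<longlongrightarrow> exp (- v\<^sup>2 / 2)) at_top"
            by (simp add: power2_eq_square)
          moreover have "((\<lambda>z. \<alpha> * (v / sqrt z)) \<longlongrightarrow> 0) at_top"
            by (intro tendsto_mult_right_zero) real_asymp
          then have "((\<lambda>z. cosh (\<alpha> * (v / sqrt z))) \<longlongrightarrow> cosh 0) at_top"
            by (intro tendsto_intros)
          ultimately have "((\<lambda>z. exp (- z * (cosh (v / sqrt z) - 1)) * cosh (\<alpha> * (v / sqrt z))) \<longlongrightarrow> exp (- v\<^sup>2 / 2) * cosh 0) at_top"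
            by (rule tendsto_mult)
          then show ?thesis by simp
        qed
        with True show ?thesis by (simp add: s_def)
      qed (simp add: s_def)
    qed
    show "(\<lambda>v. indicator {0<..} v * exp (- v\<^sup>2 / 2)) \<in> borel_measurable (lborel :: real measure)"
      by measurable
    show "s z \<in> borel_measurable lborel" for z
    proof -
      have "(\<lambda>v. exp (- z * (cosh (v / sqrt z) - 1)) * cosh (\<alpha> * (v / sqrt z))) \<in> borel_measurable borel"
        unfolding cosh_field_def by measurable
      then show ?thesis unfolding s_def by measurable
    qed
  qed
  also have "(LBINT v. indicator {0<..} v * exp (- v\<^sup>2 / 2)) = sqrt (pi / 2)"
  proof -
    have "(LBINT v. indicator {0<..} v * exp (- v\<^sup>2 / 2)) = \<bar>sqrt 2\<bar> *\<^sub>R (LBINT v. indicator {0<..} (0 + sqrt 2 * v) * exp (- (0 + sqrt 2 * v)\<^sup>2 / 2))"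
      by (rule lborel_integral_real_affine) simp
    also have "(LBINT v. indicator {0<..} (0 + sqrt 2 * v) * exp (- (0 + sqrt 2 * v)\<^sup>2 / 2)) = (LBINT v. indicator {0..} v *\<^sub>R exp (- v\<^sup>2))"
      
    proof (rule integral_cong_AE)
      show "AE v in lborel. indicator {0<..} (0 + sqrt 2 * v) * exp (- (0 + sqrt 2 * v)\<^sup>2 / 2) = indicator {0..} v *\<^sub>R exp (- v\<^sup>2)"
        using AE_lborel_singleton[of 0]
        by eventually_elim (auto simp: indicator_def power_mult_distrib zero_less_mult_iff)
    qed measurable
    also have "\<dots> = sqrt pi / 2" using gaussian_moment_0 by (rule has_bochner_integral_integral_eq)
    also have "\<bar>sqrt 2\<bar> *\<^sub>R (sqrt pi / 2) = sqrt (pi / 2)"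
      by (simp add: real_sqrt_divide field_simps)
    finally show ?thesis .
  qed
  finally have "((\<lambda>z. sqrt (2 / pi) * (LBINT v. s z v)) \<longlongrightarrow> sqrt (2 / pi) * sqrt (pi / 2)) at_top"
    by (intro tendsto_intros)
  moreover have "eventually (\<lambda>z. sqrt (2 / pi) * (LBINT v. s z v) = sqrt (2 * z / pi) * exp z * Bessel_K \<alpha> z) at_top"
    using eventually_gt_at_top[of 0] by eventually_elim (simp add: sub real_sqrt_mult real_sqrt_divide)
  moreover have "sqrt (2 / pi) * sqrt (pi / 2) = 1" by (simp flip: real_sqrt_mult)
  ultimately show ?thesis using Lim_transform_eventually by fastforce
qed

end

theory Submission
  imports Defs
begin

text \<open>
  Up to location and scale, the density is that of a symmetric beta variable (\<open>q < 1\<close>) or of a Student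
  variable (\<open>q > 1\<close>). In the first case, integration by parts gives a two-term recursion for the even
  moments, and summing the exponential series against them yields the hypergeometric series. In the
  second case, \<open>(1 + x\<^sup>2) powr - p\<close> is written as a Gamma mixture of centred Gaussians; Fubini reduces
  the characteristic function to an integral of \<open>w powr (\<alpha> - 1) * exp (- w - s\<^sup>2 / (4 * w))\<close>, which the
  substitution \<open>w = (s / 2) * exp u\<close> turns into the integral defining \<open>Bessel_K\<close>.
\<close>

subsection \<open>Location-scale families\<close>

text \<open>The two shapes call for different methods. For \<open>q < 1\<close> the support is
  bounded, so all moments exist and the exponential series may be integrated term by term. For
  \<open>q > 1\<close> the Student law has finite absolute moments only of order below \<nu>, so no
  moment series is available, and the heavy tail is instead averaged out of Gaussians, whose
  transforms are explicit. The Bessel order \<open>\<nu> / 2\<close> comes from this averaging: the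
  density has exponent \<open>- (\<nu> / 2 + 1 / 2)\<close>, and integrating a Gaussian over
  \<open>x\<close> yields \<open>sqrt (pi / w)\<close>, which absorbs the extra one half. The origin
  is delicate: the substitution leading to \<open>Bessel_K\<close> degenerates at
  \<open>s = 0\<close>. The mixture integral survives there and supplies the total mass of the
  Student density; continuity of characteristic functions then gives the limit in case (iii). The
  Beta and Gamma integrals are gauge integrals, whereas \<open>char\<close> is a Bochner integral.
  Nonnegativity allows the passage between the two, and the next lemma performs it.\<close>

lemma has_integral_nonneg_imp_has_bochner_integral:
  fixes f :: "'a::euclidean_space \<Rightarrow> real"
  assumes meas: "(\<lambda>x. indicator S x * f x) \<in> borel_measurable borel"
    and nonneg: "\<And>x. x \<in> S \<Longrightarrow> 0 \<le> f x" and int: "(f has_integral I) S"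
  shows "has_bochner_integral lborel (\<lambda>x. indicator S x * f x) I"
proof (rule has_bochner_integral_nn_integral)
  show "AE x in lborel. 0 \<le> indicator S x * f x"
    using nonneg by (auto simp: indicator_def)
  show "0 \<le> I"
    using int nonneg by (rule has_integral_nonneg)
  show "(\<integral>\<^sup>+x. ennreal (indicator S x * f x) \<partial>lborel) = ennreal I"
    using nn_integral_has_integral_lebesgue[OF nonneg int] by simp
qed (use meas in simp)

lemma char_density:
  assumes [measurable]: "f \<in> borel_measurable borel" and "\<And>x. 0 \<le> f x"
  shows "char (density lborel (\<lambda>x. ennreal (f x))) t = (\<integral>x. f x *\<^sub>R iexp (t * x) \<partial>lborel)"
  unfolding char_def using assms by (subst integral_density) auto

text \<open>Stated for densities and an arbitrary base density \<open>g\<close>, so that one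
  substitution serves twice: for \<mu> and \<sigma> of the Tsallis family, and, with location 0, for
  comparing the standard Tsallis density with a beta or Student density.\<close>

lemma char_density_location_scale:
  assumes [measurable]: "g \<in> borel_measurable borel" and g: "\<And>x. 0 \<le> g x"
    and f: "\<And>x. f x = g ((x - \<mu>) / \<sigma>) / \<sigma>" and \<sigma>: "0 < \<sigma>"
  shows "char (density lborel (\<lambda>x. ennreal (f x))) t
       = iexp (t * \<mu>) * char (density lborel (\<lambda>x. ennreal (g x))) (\<sigma> * t)"
proof -
  have "(\<integral>x. f x *\<^sub>R iexp (t * x) \<partial>lborel)
      = \<bar>\<sigma>\<bar> *\<^sub>R (\<integral>x. f (\<mu> + \<sigma> * x) *\<^sub>R iexp (t * (\<mu> + \<sigma> * x)) \<partial>lborel)"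
    using \<sigma> by (intro lborel_integral_real_affine) simp
  also have "(\<lambda>x. f (\<mu> + \<sigma> * x) *\<^sub>R iexp (t * (\<mu> + \<sigma> * x)))
      = (\<lambda>x. (iexp (t * \<mu>) / of_real \<sigma>) * (g x *\<^sub>R iexp (\<sigma> * t * x)))"
    using \<sigma> by (auto simp: f fun_eq_iff scaleR_conv_of_real algebra_simps simp flip: exp_add)
  finally have "(\<integral>x. f x *\<^sub>R iexp (t * x) \<partial>lborel) = iexp (t * \<mu>) * (\<integral>x. g x *\<^sub>R iexp (\<sigma> * t * x) \<partial>lborel)"
    using \<sigma> by (simp add: scaleR_conv_of_real)
  moreover have "f = (\<lambda>x. g ((x - \<mu>) / \<sigma>) / \<sigma>)"
    using f by auto
  then have "f \<in> borel_measurable borel" "0 \<le> f x" for x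
    using g \<sigma> by auto
  ultimately show ?thesis
    using g by (simp add: char_density)
qed

text \<open>The integral of \<open>k\<close> is \<open>a * c\<close>, so \<open>c\<close> cancels.
  The kernel therefore only has to be matched with a known probability density up to a nonzero
  factor, and its normalizing constant is never evaluated.\<close>

lemma normalized_eq_scaled_pdf:
  fixes g k :: "real \<Rightarrow> real"
  assumes k: "\<And>x. k x = c * g (x / a)" and "c \<noteq> 0" "0 < a" and g: "(\<integral>x. g x \<partial>lborel) = 1"
  shows "k x / (\<integral>x. k x \<partial>lborel) = g (x / a) / a"
proof -
  have "(\<integral>x. k x \<partial>lborel) = \<bar>a\<bar> *\<^sub>R (\<integral>x. k (0 + a * x) \<partial>lborel)"
    using assms by (intro lborel_integral_real_affine) simp
  also have "\<dots> = a * c"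
    using assms by simp
  finally show ?thesis
    using assms by simp
qed

section \<open>Scaling of the Tsallis density\<close>

lemma borel_measurable_tqg_kernel [measurable]: "tqg_kernel \<mu> \<sigma> q \<in> borel_measurable borel"
  unfolding tqg_kernel_def by measurable

lemma borel_measurable_tqg_density [measurable]: "tqg_density \<mu> \<sigma> q \<in> borel_measurable borel"
  unfolding tqg_density_def by measurable

lemma tqg_density_nonneg: "0 \<le> tqg_density \<mu> \<sigma> q x"
  unfolding tqg_density_def
  by (auto intro!: divide_nonneg_nonneg integral_nonneg simp: tqg_kernel_def)

lemma tqg_density_location_scale:
  assumes "0 < \<sigma>"
  shows "tqg_density \<mu> \<sigma> q x = tqg_density 0 1 q ((x - \<mu>) / \<sigma>) / \<sigma>"
proof (cases "q = 1")
  case True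
  then show ?thesis
    using assms by (simp add: tqg_density_def normal_density_def real_sqrt_mult power_divide)
next
  case False
  have eq: "tqg_kernel \<mu> \<sigma> q y = tqg_kernel 0 1 q ((y - \<mu>) / \<sigma>)" for y
    by (simp add: tqg_kernel_def)
  have "(\<integral>y. tqg_kernel \<mu> \<sigma> q y \<partial>lborel) = \<bar>\<sigma>\<bar> *\<^sub>R (\<integral>y. tqg_kernel \<mu> \<sigma> q (\<mu> + \<sigma> * y) \<partial>lborel)"
    using assms by (intro lborel_integral_real_affine) simp
  then have "(\<integral>y. tqg_kernel \<mu> \<sigma> q y \<partial>lborel) = \<sigma> * (\<integral>y. tqg_kernel 0 1 q y \<partial>lborel)"
    \<comment> \<open>Only the integral on the right is rewritten; there the standardized argument
      collapses to \<open>y\<close>.\<close>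
    using assms by (subst (asm) (2) eq) simp
  then show ?thesis
    using False by (simp add: tqg_density_def eq[of x])
qed

lemma char_TQG_location_scale:
  assumes "0 < \<sigma>"
  shows "char (TQG \<mu> \<sigma> q) t = iexp (t * \<mu>) * char (TQG 0 1 q) (\<sigma> * t)"
  unfolding TQG_def using assms tqg_density_location_scale[OF assms]
  by (intro char_density_location_scale) (auto simp: tqg_density_nonneg)

lemma char_TQG_standard_eq_scaled:
  assumes "q \<noteq> 1" and k: "\<And>x. tqg_kernel 0 1 q x = c * g (x / a)" and "c \<noteq> 0" "0 < a"
    and [measurable]: "g \<in> borel_measurable borel" and "\<And>x. 0 \<le> g x" "(\<integral>x. g x \<partial>lborel) = 1"
  shows "char (TQG 0 1 q) t = char (density lborel (\<lambda>x. ennreal (g x))) (a * t)"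
proof -
  have "tqg_density 0 1 q x = g ((x - 0) / a) / a" for x
  proof -
    have "tqg_kernel 0 1 q x / (\<integral>x. tqg_kernel 0 1 q x \<partial>lborel) = g (x / a) / a"
      by (rule normalized_eq_scaled_pdf[of "tqg_kernel 0 1 q" c g a]) (use assms in auto)
    then show ?thesis
      using \<open>q \<noteq> 1\<close> by (simp add: tqg_density_def)
  qed
  then have "char (TQG 0 1 q) t = iexp (t * 0) * char (density lborel (\<lambda>x. ennreal (g x))) (a * t)"
    unfolding TQG_def using assms by (intro char_density_location_scale) auto
  then show ?thesis
    by simp
qed

subsection \<open>The symmetric beta distribution\<close>

text \<open>Density of \<open>2 * B - 1\<close>: the factor 2 is the Jacobian, and
  \<open>x * (1 - x) = (1 - y^2) / 4\<close> at \<open>x = (1 + y) / 2\<close> produces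
  \<open>4 powr (\<theta> - 1)\<close>.\<close>

definition beta_symmetric_pdf :: "real \<Rightarrow> real \<Rightarrow> real" where
  "beta_symmetric_pdf \<theta> y
     = indicator {-1<..<1} y * (1 - y\<^sup>2) powr (\<theta> - 1) / (2 * 4 powr (\<theta> - 1) * Beta \<theta> \<theta>)"

lemma borel_measurable_beta_symmetric_pdf [measurable]: "beta_symmetric_pdf \<theta> \<in> borel_measurable borel"
  unfolding beta_symmetric_pdf_def by measurable

lemma Beta_real_pos: "0 < a \<Longrightarrow> 0 < b \<Longrightarrow> 0 < Beta a (b::real)"
  by (simp add: Beta_def Gamma_real_pos)

lemma beta_symmetric_pdf_nonneg: "0 < \<theta> \<Longrightarrow> 0 \<le> beta_symmetric_pdf \<theta> y"
  using Beta_real_pos[of \<theta> \<theta>] by (simp add: beta_symmetric_pdf_def)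

text \<open>The argument is left as \<open>1 / 2 + 1 / 2 * y\<close> because this is the shape in
  which the affine substitution lemmas deliver it.\<close>

lemma beta_symmetric_pdf_eq_beta_density:
  "beta_symmetric_pdf \<theta> y
     = (indicator {0<..<1} (1 / 2 + 1 / 2 * y)
         * ((1 / 2 + 1 / 2 * y) powr (\<theta> - 1) * (1 - (1 / 2 + 1 / 2 * y)) powr (\<theta> - 1) / Beta \<theta> \<theta>)) / 2"
proof (cases "-1 < y \<and> y < 1")
  case True
  have "(1 / 2 + 1 / 2 * y) powr (\<theta> - 1) * (1 - (1 / 2 + 1 / 2 * y)) powr (\<theta> - 1)
      = ((1 / 2 + 1 / 2 * y) * (1 - (1 / 2 + 1 / 2 * y))) powr (\<theta> - 1)"
    by (rule powr_mult[symmetric])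
  also have "(1 / 2 + 1 / 2 * y) * (1 - (1 / 2 + 1 / 2 * y)) = (1 - y\<^sup>2) / 4"
    by (simp add: power2_eq_square field_simps)
  also have "\<dots> powr (\<theta> - 1) = (1 - y\<^sup>2) powr (\<theta> - 1) / 4 powr (\<theta> - 1)"
    by (rule powr_divide)
  finally show ?thesis
    using True by (simp add: beta_symmetric_pdf_def)
next
  case False
  then show ?thesis
    by (auto simp: beta_symmetric_pdf_def indicator_def)
qed

lemma has_bochner_integral_beta_symmetric_pdf:
  assumes "0 < \<theta>"
  shows "has_bochner_integral lborel (beta_symmetric_pdf \<theta>) 1"
proof -
  define h where "h x = indicator {0<..<1} x * (x powr (\<theta> - 1) * (1 - x) powr (\<theta> - 1))" for x :: real
  \<comment> \<open>The endpoints form a null set, so the interval of the Beta integral may be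
    opened to match the indicator.\<close>
  have "((\<lambda>t. t powr (\<theta> - 1) * (1 - t) powr (\<theta> - 1)) has_integral Beta \<theta> \<theta>) {0<..<1}"
    using has_integral_Beta_real[OF assms assms] by (simp add: has_integral_Icc_iff_Ioo)
  then have "has_bochner_integral lborel h (Beta \<theta> \<theta>)"
    unfolding h_def by (intro has_integral_nonneg_imp_has_bochner_integral) auto
  then have "has_bochner_integral lborel (\<lambda>y. h (1 / 2 + 1 / 2 * y)) (Beta \<theta> \<theta> /\<^sub>R \<bar>1 / 2\<bar>)"
    by (subst lborel_has_bochner_integral_real_affine_iff[symmetric]) auto
  then have "has_bochner_integral lborel (\<lambda>y. h (1 / 2 + 1 / 2 * y) * (1 / (2 * Beta \<theta> \<theta>)))
               (Beta \<theta> \<theta> /\<^sub>R \<bar>1 / 2\<bar> * (1 / (2 * Beta \<theta> \<theta>)))"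
    by (rule has_bochner_integral_mult_left)
  moreover have "(\<lambda>y. h (1 / 2 + 1 / 2 * y) * (1 / (2 * Beta \<theta> \<theta>))) = beta_symmetric_pdf \<theta>"
    by (auto simp: fun_eq_iff beta_symmetric_pdf_eq_beta_density h_def)
  ultimately show ?thesis
    using Beta_real_pos[OF assms assms] by simp
qed

lemma char_BetaSymmetric_eq:
  assumes "0 < \<theta>"
  shows "char (BetaSymmetric \<theta>) t = char (density lborel (\<lambda>x. ennreal (beta_symmetric_pdf \<theta> x))) t"
proof -
  define h where "h x = indicator {0<..<1} x * (x powr (\<theta> - 1) * (1 - x) powr (\<theta> - 1) / Beta \<theta> \<theta>)" for x :: real
  have [measurable]: "h \<in> borel_measurable borel"
    unfolding h_def by measurable
  have h: "0 \<le> h x" for x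
    using Beta_real_pos[OF assms assms] by (simp add: h_def)
  have "char (BetaSymmetric \<theta>) t = (\<integral>x. iexp (t * (2 * x - 1)) \<partial>density lborel (\<lambda>x. ennreal (h x)))"
    unfolding char_def BetaSymmetric_def beta_distribution_def h_def
    by (subst integral_distr) auto
  also have "\<dots> = (\<integral>x. h x *\<^sub>R iexp (t * (2 * x - 1)) \<partial>lborel)"
    using h by (subst integral_density) auto
  also have "\<dots> = \<bar>1 / 2\<bar> *\<^sub>R (\<integral>y. h (1 / 2 + 1 / 2 * y) *\<^sub>R iexp (t * (2 * (1 / 2 + 1 / 2 * y) - 1)) \<partial>lborel)"
    by (rule lborel_integral_real_affine) simp
  also have "\<dots> = (\<integral>y. (h (1 / 2 + 1 / 2 * y) / 2) *\<^sub>R iexp (t * y) \<partial>lborel)"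
    by (subst integral_scaleR_right[symmetric]) (auto intro!: Bochner_Integration.integral_cong simp: field_simps)
  also have "(\<lambda>y. h (1 / 2 + 1 / 2 * y) / 2) = beta_symmetric_pdf \<theta>"
    by (auto simp: fun_eq_iff beta_symmetric_pdf_eq_beta_density h_def)
  finally show ?thesis
    using assms by (simp add: char_density beta_symmetric_pdf_nonneg)
qed

section \<open>Moments of the symmetric beta law\<close>

lemma integrable_beta_symmetric_pdf_power:
  assumes "0 < \<theta>"
  shows "integrable lborel (\<lambda>y. beta_symmetric_pdf \<theta> y * y ^ n)"
proof (rule Bochner_Integration.integrable_bound)
  show "integrable lborel (beta_symmetric_pdf \<theta>)"
    using has_bochner_integral_beta_symmetric_pdf[OF assms] by (simp add: has_bochner_integral_iff)
  show "AE y in lborel. norm (beta_symmetric_pdf \<theta> y * y ^ n) \<le> norm (beta_symmetric_pdf \<theta> y)"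
  proof (rule AE_I2)
    fix y :: real
    show "norm (beta_symmetric_pdf \<theta> y * y ^ n) \<le> norm (beta_symmetric_pdf \<theta> y)"
    proof (cases "-1 < y \<and> y < 1")
      case True
      then have "\<bar>y\<bar> ^ n \<le> 1"
        by (intro power_le_one) auto
      then show ?thesis
        by (simp add: abs_mult power_abs mult_left_le)
    qed (auto simp: beta_symmetric_pdf_def indicator_def)
  qed
qed measurable

lemma beta_symmetric_odd_moment:
  assumes "odd n"
  shows "(\<integral>y. beta_symmetric_pdf \<theta> y * y ^ n \<partial>lborel) = 0"
proof -
  have "(\<integral>y. beta_symmetric_pdf \<theta> y * y ^ n \<partial>lborel)
      = \<bar>-1\<bar> *\<^sub>R (\<integral>y. beta_symmetric_pdf \<theta> (0 + (-1) * y) * (0 + (-1) * y) ^ n \<partial>lborel)"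
    by (rule lborel_integral_real_affine) simp
  also have "\<dots> = (\<integral>y. - (beta_symmetric_pdf \<theta> y * y ^ n) \<partial>lborel)"
    using assms by (auto simp: beta_symmetric_pdf_def indicator_def intro!: Bochner_Integration.integral_cong)
  finally show ?thesis
    by simp
qed

text \<open>
  Integrating the derivative of \<open>y ^ (2 * k + 1) * (1 - y\<^sup>2) powr \<theta>\<close> over \<open>[-1, 1]\<close> relates
  consecutive even moments.
\<close>

lemma beta_symmetric_even_moment_Suc:
  assumes "0 < \<theta>"
  shows "(\<integral>y. beta_symmetric_pdf \<theta> y * y ^ (2 * Suc k) \<partial>lborel)
       = (real k + 1 / 2) / (\<theta> + 1 / 2 + real k) * (\<integral>y. beta_symmetric_pdf \<theta> y * y ^ (2 * k) \<partial>lborel)"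
proof -
  define N where "N = 2 * 4 powr (\<theta> - 1) * Beta \<theta> \<theta>"
  define M where "M n = (\<integral>y. beta_symmetric_pdf \<theta> y * y ^ n \<partial>lborel)" for n
  define G where "G y = (2 * real k + 1) * (beta_symmetric_pdf \<theta> y * y ^ (2 * k))
      - (2 * real k + 1 + 2 * \<theta>) * (beta_symmetric_pdf \<theta> y * y ^ (2 * Suc k))" for y
  have "has_bochner_integral lborel G ((2 * real k + 1) * M (2 * k) - (2 * real k + 1 + 2 * \<theta>) * M (2 * Suc k))"
    unfolding G_def M_def
    by (intro has_bochner_integral_diff has_bochner_integral_mult_right has_bochner_integral_integrable
          integrable_beta_symmetric_pdf_power assms)
  then have "(G has_integral ((2 * real k + 1) * M (2 * k) - (2 * real k + 1 + 2 * \<theta>) * M (2 * Suc k))) UNIV"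
    using has_integral_integral_lborel[of G] by (simp only: has_bochner_integral_iff)
  then have "((\<lambda>y. if y \<in> {-1..1} then G y else 0) has_integral
      ((2 * real k + 1) * M (2 * k) - (2 * real k + 1 + 2 * \<theta>) * M (2 * Suc k))) UNIV"
    by (rule has_integral_eq[rotated]) (auto simp: G_def beta_symmetric_pdf_def indicator_def)
  then have 1: "(G has_integral ((2 * real k + 1) * M (2 * k) - (2 * real k + 1 + 2 * \<theta>) * M (2 * Suc k))) {-1..1}"
    by (simp only: has_integral_restrict_UNIV)
  \<comment> \<open>Both boundary values vanish because \<open>0 powr \<theta> = 0\<close>.
    Comparing with the first evaluation of the same integral leaves a linear relation between two
    moments.\<close>
  have 2: "(G has_integral (1 ^ (2 * k + 1) * (1 - 1\<^sup>2) powr \<theta> / N - (-1) ^ (2 * k + 1) * (1 - (-1)\<^sup>2) powr \<theta> / N)) {-1..1}"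
  \<comment> \<open>For \<open>\<theta> < 1\<close> the antiderivative has infinite slope at the
    endpoints. Hence the version that asks for continuity on the closed interval and
    differentiability only inside it; continuity at the zeros of the base uses
    \<open>0 < \<theta>\<close>.\<close>
  proof (rule fundamental_theorem_of_calculus_interior)
    show "continuous_on {-1..1} (\<lambda>y. y ^ (2 * k + 1) * (1 - y\<^sup>2) powr \<theta> / N)"
      unfolding divide_inverse
      using assms by (intro continuous_intros continuous_on_powr') (auto simp: abs_square_le_1)
    fix y :: real
    assume y: "y \<in> {-1<..<1}"
    then have pos: "0 < 1 - y\<^sup>2"
      by (simp add: abs_square_less_1 abs_less_iff)
    define P where "P = (1 - y\<^sup>2) powr (\<theta> - 1)"
    have Q: "(1 - y\<^sup>2) powr \<theta> = (1 - y\<^sup>2) * P"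
      using pos by (simp add: P_def powr_diff)
    have pdf: "beta_symmetric_pdf \<theta> y = P / N"
      using y by (simp add: beta_symmetric_pdf_def P_def N_def)
    have G: "(real (2 * k + 1) * y ^ (2 * k) * (1 - y\<^sup>2) powr \<theta>
              - y ^ (2 * k + 1) * (2 * y * \<theta> * (1 - y\<^sup>2) powr (\<theta> - 1))) / N = G y"
      unfolding G_def pdf Q P_def[symmetric]
      by (simp add: algebra_simps power2_eq_square
        add_divide_distrib diff_divide_distrib)
    have "((\<lambda>y. y ^ (2 * k + 1)) has_real_derivative real (2 * k + 1) * y ^ (2 * k)) (at y)"
      using DERIV_pow[of "2 * k + 1" y] by simp
    moreover have "((\<lambda>y. (1 - y\<^sup>2) powr \<theta>) has_real_derivative
        \<theta> * (1 - y\<^sup>2) powr (\<theta> - 1) * - (2 * y)) (at y)"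
      using pos by (auto intro!: derivative_eq_intros)
    ultimately have "((\<lambda>y. y ^ (2 * k + 1) * (1 - y\<^sup>2) powr \<theta> / N) has_real_derivative
        (real (2 * k + 1) * y ^ (2 * k) * (1 - y\<^sup>2) powr \<theta>
          + \<theta> * (1 - y\<^sup>2) powr (\<theta> - 1) * - (2 * y) * y ^ (2 * k + 1)) / N) (at y)"
      by (intro DERIV_cdivide DERIV_mult)
    also have "real (2 * k + 1) * y ^ (2 * k) * (1 - y\<^sup>2) powr \<theta>
          + \<theta> * (1 - y\<^sup>2) powr (\<theta> - 1) * - (2 * y) * y ^ (2 * k + 1)
        = real (2 * k + 1) * y ^ (2 * k) * (1 - y\<^sup>2) powr \<theta>
          - y ^ (2 * k + 1) * (2 * y * \<theta> * (1 - y\<^sup>2) powr (\<theta> - 1))"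
      by simp
    finally have "((\<lambda>y. y ^ (2 * k + 1) * (1 - y\<^sup>2) powr \<theta> / N) has_real_derivative G y) (at y)"
      by (simp only: G)
    then show "((\<lambda>y. y ^ (2 * k + 1) * (1 - y\<^sup>2) powr \<theta> / N) has_vector_derivative G y) (at y)"
      by (simp only: has_real_derivative_iff_has_vector_derivative)
  qed simp
  have "(2 * real k + 1) * M (2 * k) - (2 * real k + 1 + 2 * \<theta>) * M (2 * Suc k) = 0"
    using has_integral_unique[OF 1 2] by simp
  then show ?thesis
    using assms unfolding M_def[symmetric] by (simp add: field_simps del: mult_Suc_right)
qed

text \<open>The factors of the recursion telescope: the denominators into a ratio of Gamma values,
  the numerators \<open>j + 1 / 2\<close> into \<open>fact (2 * k) / (4 ^ k * fact k)\<close>. This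
  form keeps \<open>fact (2 * k)\<close> visible, to be cancelled by the exponential series.\<close>

lemma beta_symmetric_even_moment:
  assumes "0 < \<theta>"
  shows "(\<integral>y. beta_symmetric_pdf \<theta> y * y ^ (2 * k) \<partial>lborel)
       = Gamma (\<theta> + 1 / 2) / Gamma (\<theta> + 1 / 2 + real k) * fact (2 * k) / (4 ^ k * fact k)"
proof (induction k)
  case 0
  show ?case
  proof -
    have "0 < Gamma (\<theta> + 1 / 2)"
      using assms by (intro Gamma_real_pos) simp
    then show ?thesis
      using has_bochner_integral_beta_symmetric_pdf[OF assms] by (simp add: has_bochner_integral_iff)
  qed
next
  case (Suc k)
  have pos: "0 < Gamma (\<theta> + 1 / 2 + real k)"
    using assms by (intro Gamma_real_pos) auto
  have "\<theta> + 1 / 2 + real k \<notin> \<int>\<^sub>\<le>\<^sub>0"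
    using assms by (auto elim!: nonpos_Ints_cases)
  then have "Gamma (\<theta> + 1 / 2 + real (Suc k)) = (\<theta> + 1 / 2 + real k) * Gamma (\<theta> + 1 / 2 + real k)"
    using Gamma_plus1[of "\<theta> + 1 / 2 + real k"] by (simp add: add_ac)
  moreover have "(fact (2 * Suc k) :: real) = 4 * (real k + 1 / 2) * (real k + 1) * fact (2 * k)"
    by (simp add: field_simps)
  moreover have "(fact (Suc k) :: real) = (real k + 1) * fact k"
    by simp
  \<comment> \<open>The cancellation is stated for opaque variables so that plain rewriting can
    apply it. \<open>T\<close> stands for \<open>real k + 1\<close>, the factor common to
    \<open>fact (Suc k)\<close> and \<open>fact (2 * Suc k)\<close>.\<close>
  moreover have "Y / X * (G / A * F / (P * Q)) = G / (X * A) * (4 * Y * T * F) / (4 * P * (T * Q))"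
    if "T \<noteq> 0" for Y T X A F P Q G :: real
    using that by simp
  ultimately show ?case
    unfolding beta_symmetric_even_moment_Suc[OF assms] Suc.IH power_Suc using pos assms
    by (simp only:)
qed

text \<open>Since the density lives on \<open>(-1, 1)\<close>, the \<open>n\<close>-th term of the
  series has norm at most \<open>\<bar>t\<bar> ^ n / fact n\<close> times the density. This summable
  bound justifies exchanging sum and integral. Odd moments vanish by symmetry, and the even ones
  turn the rest into the series of \<open>hyp0F1\<close>.\<close>

lemma char_beta_symmetric_pdf_sums:
  assumes "0 < \<theta>"
  shows "(\<lambda>k. complex_of_real (Gamma (\<theta> + 1 / 2) / Gamma (\<theta> + 1 / 2 + real k)
            * ((- (1 / 4) * t\<^sup>2) ^ k / fact k)))
         sums char (density lborel (\<lambda>x. ennreal (beta_symmetric_pdf \<theta> x))) t"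
proof -
  define f where "f = beta_symmetric_pdf \<theta>"
  have f: "0 \<le> f y" for y
    using assms by (simp add: f_def beta_symmetric_pdf_nonneg)
  have f0: "f y = 0" if "\<not> (-1 < y \<and> y < 1)" for y
    using that by (auto simp: f_def beta_symmetric_pdf_def indicator_def)
  have [measurable]: "f \<in> borel_measurable borel"
    by (simp add: f_def)
  have f1: "integrable lborel f"
    using integrable_beta_symmetric_pdf_power[OF assms, of 0] by (simp add: f_def)
  define g where "g n y = f y *\<^sub>R ((\<i> * of_real (t * y)) ^ n / fact n)" for n y
  have g_eq: "g n y = ((\<i> * of_real t) ^ n / fact n) * of_real (f y * y ^ n)" for n y
    by (simp add: g_def scaleR_conv_of_real power_mult_distrib)
  have norm_g: "norm (g n y) = \<bar>t * y\<bar> ^ n / fact n * f y" for n y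
    using f by (simp add: g_def norm_mult norm_divide norm_power abs_mult)
  have expS: "(\<lambda>n. z ^ n / fact n) sums exp z" for z :: "'a :: {banach, real_normed_field}"
    using exp_converges[of z] by (simp add: scaleR_conv_of_real divide_inverse mult.commute)
  have "(\<lambda>n. integral\<^sup>L lborel (g n)) sums (\<integral>y. (\<Sum>n. g n y) \<partial>lborel)"
  proof (rule sums_integral)
    show int: "integrable lborel (g n)" for n
      unfolding g_eq using integrable_beta_symmetric_pdf_power[OF assms, of n]
      by (intro integrable_mult_right integrable_of_real) (simp add: f_def)
    show "AE y in lborel. summable (\<lambda>n. norm (g n y))"
      unfolding norm_g by (intro AE_I2 summable_mult2) (use expS sums_summable in blast)
    show "summable (\<lambda>n. \<integral>y. norm (g n y) \<partial>lborel)"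
    proof (rule summable_comparison_test'[of "\<lambda>n. \<bar>t\<bar> ^ n / fact n * (\<integral>y. f y \<partial>lborel)" 0])
      show "summable (\<lambda>n. \<bar>t\<bar> ^ n / fact n * (\<integral>y. f y \<partial>lborel))"
        by (intro summable_mult2) (use expS sums_summable in blast)
      fix n :: nat
      have "(\<integral>y. norm (g n y) \<partial>lborel) \<le> (\<integral>y. \<bar>t\<bar> ^ n / fact n * f y \<partial>lborel)"
      proof (rule integral_mono)
        show "norm (g n y) \<le> \<bar>t\<bar> ^ n / fact n * f y" for y
        proof (cases "-1 < y \<and> y < 1")
          case True
          then have "\<bar>t * y\<bar> \<le> \<bar>t\<bar>"
            by (auto simp: abs_mult intro: mult_left_le)
          then show ?thesis
            unfolding norm_g using f by (intro mult_right_mono divide_right_mono power_mono) auto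
        qed (simp add: norm_g f0)
      qed (use int f1 in auto)
      then show "norm (\<integral>y. norm (g n y) \<partial>lborel) \<le> \<bar>t\<bar> ^ n / fact n * (\<integral>y. f y \<partial>lborel)"
        by simp
    qed
  qed
  moreover have "(\<Sum>n. g n y) = f y *\<^sub>R iexp (t * y)" for y
    unfolding g_def using expS[of "\<i> * of_real (t * y)"]
    by (intro sums_unique[symmetric] sums_scaleR_right)
  moreover have "integral\<^sup>L lborel (g n) = ((\<i> * of_real t) ^ n / fact n) * of_real (\<integral>y. f y * y ^ n \<partial>lborel)" for n
    unfolding g_eq by (simp only: integral_mult_right_zero integral_complex_of_real)
  ultimately have S: "(\<lambda>n. ((\<i> * of_real t) ^ n / fact n) * of_real (\<integral>y. f y * y ^ n \<partial>lborel))
      sums char (density lborel (\<lambda>x. ennreal (f x))) t"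
    using f by (simp add: char_density)
  have "(\<lambda>k. ((\<i> * of_real t) ^ (2 * k) / fact (2 * k)) * of_real (\<integral>y. f y * y ^ (2 * k) \<partial>lborel))
      sums char (density lborel (\<lambda>x. ennreal (f x))) t"
  \<comment> \<open>Reindexing along the even numbers is allowed because every omitted term contains
    an odd moment.\<close>
  proof (subst sums_mono_reindex[of "\<lambda>k. 2 * k"])
    show "strict_mono (\<lambda>k::nat. 2 * k)"
      by (auto simp: strict_mono_def)
    fix n :: nat
    assume "n \<notin> range (\<lambda>k. 2 * k)"
    then have "odd n"
      by auto
    then show "((\<i> * of_real t) ^ n / fact n) * of_real (\<integral>y. f y * y ^ n \<partial>lborel) = (0::complex)"
      unfolding f_def by (subst beta_symmetric_odd_moment) simp_all
  qed (rule S)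
  moreover have "((\<i> * of_real t) ^ (2 * k) / fact (2 * k)) * of_real (\<integral>y. f y * y ^ (2 * k) \<partial>lborel)
      = complex_of_real (Gamma (\<theta> + 1 / 2) / Gamma (\<theta> + 1 / 2 + real k) * ((- (1 / 4) * t\<^sup>2) ^ k / fact k))" for k
  proof -
    have "(\<i> * of_real t) ^ (2 * k) = complex_of_real ((- (t\<^sup>2)) ^ k)"
      by (simp add: power_mult power_mult_distrib)
    moreover have "(- (1 / 4) * t\<^sup>2) ^ k = (- (t\<^sup>2)) ^ k / 4 ^ k"
      by (simp flip: power_divide)
    ultimately show ?thesis
      unfolding f_def beta_symmetric_even_moment[OF assms] by simp
  qed
  ultimately show ?thesis
    by (simp add: f_def)
qed

text \<open>\<open>hyp0F1\<close> is a bare \<open>suminf\<close>, so its convergence has to be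
  shown; it is inherited from the complex series just summed by taking real parts.\<close>

lemma hyp0F1_sums:
  assumes "0 < \<theta>"
  shows "(\<lambda>k. Gamma (\<theta> + 1 / 2) / Gamma (\<theta> + 1 / 2 + real k) * ((- (1 / 4) * t\<^sup>2) ^ k / fact k))
         sums hyp0F1 (\<theta> + 1 / 2) (- (1 / 4) * t\<^sup>2)"
  using sums_Re[OF char_beta_symmetric_pdf_sums[OF assms, of t]]
  unfolding hyp0F1_def Re_complex_of_real by (rule sums_summable[THEN summable_sums])

lemma char_beta_symmetric_pdf:
  assumes "0 < \<theta>"
  shows "char (density lborel (\<lambda>x. ennreal (beta_symmetric_pdf \<theta> x))) t
       = of_real (hyp0F1 (\<theta> + 1 / 2) (- (1 / 4) * t\<^sup>2))"
  using char_beta_symmetric_pdf_sums[OF assms] sums_of_real[OF hyp0F1_sums[OF assms]]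
  by (rule sums_unique2)

text \<open>With Bessel order \<open>\<theta> - 1 / 2\<close> the shift by 1 inside the Gamma
  function gives \<open>\<theta> + 1 / 2 + real k\<close>, and the prefactor cancels the power of 2
  in \<open>Bessel_J_scaled\<close>. Both sides are power series in \<open>z^2\<close>, so the sign
  of \<open>z\<close> is irrelevant.\<close>

lemma Bessel_J_scaled_eq_hyp0F1:
  assumes "0 < \<theta>"
  shows "2 powr (\<theta> - 1 / 2) * Gamma (\<theta> + 1 / 2) * Bessel_J_scaled (\<theta> - 1 / 2) z
       = hyp0F1 (\<theta> + 1 / 2) (- (1 / 4) * z\<^sup>2)"
proof -
  define c where "c k = (-1) ^ k / (fact k * Gamma (\<theta> - 1 / 2 + real k + 1)) * (z / 2) ^ (2 * k)" for k
  have eq: "Gamma (\<theta> + 1 / 2) / Gamma (\<theta> + 1 / 2 + real k) * ((- (1 / 4) * z\<^sup>2) ^ k / fact k)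
      = Gamma (\<theta> + 1 / 2) * c k" for k
  proof -
    have "(- (1 / 4) * z\<^sup>2) ^ k = (-1) ^ k * (z / 2) ^ (2 * k)"
    proof -
      have "- (1 / 4) * z\<^sup>2 = (-1) * (z / 2)\<^sup>2"
        by (simp add: power_divide)
      then show ?thesis
        by (simp only: power_mult_distrib power_mult)
    qed
    then show ?thesis
      by (simp add: c_def add_ac)
  qed
  have pos: "0 < Gamma (\<theta> + 1 / 2)"
    using assms by (intro Gamma_real_pos) simp
  have S: "(\<lambda>k. Gamma (\<theta> + 1 / 2) * c k) sums hyp0F1 (\<theta> + 1 / 2) (- (1 / 4) * z\<^sup>2)"
    using hyp0F1_sums[OF assms, of z] by (simp only: eq)
  \<comment> \<open>Dividing by the nonzero Gamma factor gives the summability needed to pull that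
    factor out of \<open>suminf\<close>.\<close>
  then have "summable c"
    using pos by (auto dest: sums_summable)
  then have "hyp0F1 (\<theta> + 1 / 2) (- (1 / 4) * z\<^sup>2) = Gamma (\<theta> + 1 / 2) * (\<Sum>k. c k)"
    using sums_unique[OF S] by (simp add: suminf_mult)
  then show ?thesis
    unfolding Bessel_J_scaled_def c_def[symmetric] by (simp flip: powr_add)
qed

subsection \<open>The Student distribution\<close>

text \<open>Read from right to left, this writes \<open>c powr - p\<close> as a mixture of the
  exponentials \<open>exp (- (w * c))\<close>. It is used with \<open>c = 1 + x^2\<close> for the
  mixture itself, and with \<open>c = 1\<close> for integrability bounds and total mass.\<close>

lemma has_bochner_integral_Gamma:
  fixes p c :: real
  assumes "0 < p" "0 < c"
  shows "has_bochner_integral lborel (\<lambda>w::real. indicator {0<..} w * (w powr (p - 1) * exp (- (w * c))))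
           (Gamma p / c powr p)"
proof -
  define h where "h w = indicator {0<..} w * (w powr (p - 1) / exp w)" for w :: real
  have "((\<lambda>w. if w \<in> {0..} then w powr (p - 1) / exp w else 0) has_integral Gamma p) UNIV"
    unfolding has_integral_restrict_UNIV by (rule Gamma_integral_real[OF assms(1)])
  \<comment> \<open>The two functions agree even at 0, where \<open>0 powr _ = 0\<close>.\<close>
  also have "(\<lambda>w. if w \<in> {0..} then w powr (p - 1) / exp w else 0)
      = (\<lambda>w. if w \<in> {0<..} then w powr (p - 1) / exp w else 0)"
    by (auto simp: fun_eq_iff)
  finally have "((\<lambda>w. w powr (p - 1) / exp w) has_integral Gamma p) {0<..}"
    unfolding has_integral_restrict_UNIV .
  then have "has_bochner_integral lborel h (Gamma p)"
    unfolding h_def by (intro has_integral_nonneg_imp_has_bochner_integral) auto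
  then have "has_bochner_integral lborel (\<lambda>w. h (0 + c * w)) (Gamma p /\<^sub>R \<bar>c\<bar>)"
    using assms by (subst lborel_has_bochner_integral_real_affine_iff[symmetric]) auto
  \<comment> \<open>The factor \<open>c powr (1 - p)\<close> removes the power of \<open>c\<close>
    that comes out of \<open>(c * w) powr (p - 1)\<close>.\<close>
  then have "has_bochner_integral lborel (\<lambda>w. h (0 + c * w) * c powr (1 - p)) (Gamma p /\<^sub>R \<bar>c\<bar> * c powr (1 - p))"
    by (rule has_bochner_integral_mult_left)
  moreover have "h (0 + c * w) * c powr (1 - p) = indicator {0<..} w * (w powr (p - 1) * exp (- (w * c)))" for w
  proof (cases "0 < w")
    case True
    have "(c * w) powr (p - 1) * c powr (1 - p) = w powr (p - 1) * (c powr (p - 1) * c powr (1 - p))"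
      by (simp add: powr_mult mult_ac)
    also have "c powr (p - 1) * c powr (1 - p) = 1"
      using assms by (simp flip: powr_add)
    finally show ?thesis
      using True assms by (simp add: h_def exp_minus divide_inverse mult_ac)
  next
    case False
    then show ?thesis
      using assms by (simp add: h_def zero_less_mult_iff)
  qed
  moreover have "Gamma p /\<^sub>R \<bar>c\<bar> * c powr (1 - p) = Gamma p / c powr p"
    using assms by (simp add: powr_diff field_simps)
  ultimately show ?thesis
    by simp
qed

section \<open>Gaussian integrals and mixtures\<close>

lemma has_bochner_integral_gaussian:
  assumes "0 < w"
  shows "has_bochner_integral lborel (\<lambda>x. exp (- (w * x\<^sup>2))) (sqrt (pi / w))"
proof -
  have "has_bochner_integral lborel (\<lambda>x. normal_density 0 (sqrt (1 / (2 * w))) x * sqrt (pi / w)) (1 * sqrt (pi / w))"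
    using assms by (intro has_bochner_integral_mult_left)
       (simp add: has_bochner_integral_iff integrable_normal_density integral_normal_density)
  moreover have "normal_density 0 (sqrt (1 / (2 * w))) x * sqrt (pi / w) = exp (- (w * x\<^sup>2))" for x
    using assms by (simp add: normal_density_def real_sqrt_divide field_simps)
  ultimately show ?thesis
    by simp
qed

lemma integral_gaussian_iexp:
  assumes "0 < w"
  shows "(\<integral>x. exp (- (w * x\<^sup>2)) *\<^sub>R iexp (s * x) \<partial>lborel) = of_real (sqrt (pi / w) * exp (- (s\<^sup>2 / (4 * w))))"
proof -
  \<comment> \<open>This scale satisfies \<open>w * (\<sigma> * x)^2 = x^2 / 2\<close>, so the
    substitution turns the weight into a multiple of the standard normal density.\<close>
  define \<sigma> where "\<sigma> = 1 / sqrt (2 * w)"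
  have \<sigma>: "0 < \<sigma>" "\<sigma>\<^sup>2 = 1 / (2 * w)"
    using assms by (simp_all add: \<sigma>_def power_divide)
  have "(\<integral>x. std_normal_density x *\<^sub>R iexp (\<sigma> * s * x) \<partial>lborel) = char std_normal_distribution (\<sigma> * s)"
    by (subst char_density) auto
  also have "\<dots> = of_real (exp (- (s\<^sup>2 / (4 * w))))"
    using \<sigma> by (simp add: char_std_normal_distribution power_mult_distrib)
  finally have std: "(\<integral>x. std_normal_density x *\<^sub>R iexp (\<sigma> * s * x) \<partial>lborel) = of_real (exp (- (s\<^sup>2 / (4 * w))))" .
  have "(\<integral>x. exp (- (w * x\<^sup>2)) *\<^sub>R iexp (s * x) \<partial>lborel)
      = \<bar>\<sigma>\<bar> *\<^sub>R (\<integral>x. exp (- (w * (0 + \<sigma> * x)\<^sup>2)) *\<^sub>R iexp (s * (0 + \<sigma> * x)) \<partial>lborel)"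
    using \<sigma> by (intro lborel_integral_real_affine) simp
  also have "(\<lambda>x. exp (- (w * (0 + \<sigma> * x)\<^sup>2)) *\<^sub>R iexp (s * (0 + \<sigma> * x)))
      = (\<lambda>x. sqrt (2 * pi) *\<^sub>R (std_normal_density x *\<^sub>R iexp (\<sigma> * s * x)))"
    using assms \<sigma> by (auto simp: fun_eq_iff normal_density_def power_mult_distrib mult_ac)
  also have "\<bar>\<sigma>\<bar> *\<^sub>R (\<integral>x. sqrt (2 * pi) *\<^sub>R (std_normal_density x *\<^sub>R iexp (\<sigma> * s * x)) \<partial>lborel)
      = of_real (\<sigma> * sqrt (2 * pi) * exp (- (s\<^sup>2 / (4 * w))))"
    unfolding integral_scaleR_right std using \<sigma> by (simp add: scaleR_conv_of_real)
  also have "\<sigma> * sqrt (2 * pi) = sqrt (pi / w)"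
    using assms by (simp add: \<sigma>_def real_sqrt_divide real_sqrt_mult)
  finally show ?thesis .
qed

text \<open>Both claims come from one function \<open>F w x\<close> of two variables. Integrating
  over \<open>w\<close> gives \<open>Gamma p * (1 + x^2) powr - p\<close> times the oscillating
  factor; integrating over \<open>x\<close> gives a Gaussian transform, whose
  \<open>1 / sqrt w\<close> lowers the exponent from \<open>p - 1\<close> to
  \<open>\<alpha> - 1\<close>.\<close>

lemma fourier_one_plus_square_powr:
  assumes "0 < \<alpha>"
  shows "integrable lborel (\<lambda>x. (1 + x\<^sup>2) powr - (\<alpha> + 1 / 2))"
    and "of_real (Gamma (\<alpha> + 1 / 2)) * (\<integral>x. (1 + x\<^sup>2) powr - (\<alpha> + 1 / 2) *\<^sub>R iexp (s * x) \<partial>lborel)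
       = of_real (sqrt pi * (\<integral>w. indicator {0<..} w * (w powr (\<alpha> - 1) * exp (- w - s\<^sup>2 / (4 * w))) \<partial>lborel))"
proof -
  define p where "p = \<alpha> + 1 / 2"
  define k where "k w = indicator {0<..} w * (w powr (p - 1) * exp (- w))" for w :: real
  define F where "F w x = (k w * exp (- (w * x\<^sup>2))) *\<^sub>R iexp (s * x)" for w x :: real
  have p: "0 < p"
    using assms by (simp add: p_def)
  have [measurable]: "k \<in> borel_measurable borel"
    unfolding k_def by measurable
  have meas: "case_prod F \<in> borel_measurable (lborel \<Otimes>\<^sub>M lborel)"
    unfolding F_def by measurable
  have k: "0 \<le> k w" for w
    by (simp add: k_def)
  have norm_F: "norm (F w x) = k w * exp (- (w * x\<^sup>2))" for w x
    using k by (simp add: F_def)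
  have k_gauss: "has_bochner_integral lborel (\<lambda>x. k w * exp (- (w * x\<^sup>2)))
      (sqrt pi * (indicator {0<..} w * (w powr (\<alpha> - 1) * exp (- (w * 1)))))" for w
  proof (cases "0 < w")
    case True
    have "w powr (p - 1) = w powr (\<alpha> - 1) * sqrt w"
      using True by (simp add: p_def powr_half_sqrt[symmetric] flip: powr_add)
    then have "k w * sqrt (pi / w) = sqrt pi * (indicator {0<..} w * (w powr (\<alpha> - 1) * exp (- (w * 1))))"
      using True by (simp add: k_def real_sqrt_divide)
    then show ?thesis
      using has_bochner_integral_mult_right[OF has_bochner_integral_gaussian[OF True], of "k w"] by simp
  qed (simp add: k_def has_bochner_integral_zero)
  \<comment> \<open>With \<open>x\<close> as the inner variable, the integral of the norm is a
    multiple of the Gamma integrand of order \<alpha>, which is integrable since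
    \<open>0 < \<alpha>\<close>.\<close>
  have int: "integrable (lborel \<Otimes>\<^sub>M lborel) (case_prod F)"
  proof (rule lborel_pair.Fubini_integrable[OF meas])
    have "integrable lborel (\<lambda>w. sqrt pi * (indicator {0<..} w * (w powr (\<alpha> - 1) * exp (- (w * 1)))))"
      using has_bochner_integral_Gamma[OF assms, of 1] by (intro integrable_mult_right) (auto simp: has_bochner_integral_iff)
    then show "integrable lborel (\<lambda>w. \<integral>x. norm (case (w, x) of (w, x) \<Rightarrow> F w x) \<partial>lborel)"
      using k_gauss by (simp add: norm_F has_bochner_integral_iff)
    show "AE w in lborel. integrable lborel (\<lambda>x. case (w, x) of (w, x) \<Rightarrow> F w x)"
    proof (rule AE_I2)
      fix w :: real
      have "integrable lborel (\<lambda>x. k w * exp (- (w * x\<^sup>2)))"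
        using k_gauss by (simp add: has_bochner_integral_iff)
      then show "integrable lborel (\<lambda>x. case (w, x) of (w, x) \<Rightarrow> F w x)"
        by (rule Bochner_Integration.integrable_bound) (use k in \<open>auto simp: F_def\<close>)
    qed
  qed
  have mix: "has_bochner_integral lborel (\<lambda>w. k w * exp (- (w * x\<^sup>2))) (Gamma p * (1 + x\<^sup>2) powr - p)" for x
  proof -
    have "0 < 1 + x\<^sup>2"
      by (simp add: add_pos_nonneg)
    then have "has_bochner_integral lborel
        (\<lambda>w. indicator {0<..} w * (w powr (p - 1) * exp (- (w * (1 + x\<^sup>2))))) (Gamma p * (1 + x\<^sup>2) powr - p)"
      using has_bochner_integral_Gamma[OF p] by (simp add: powr_minus divide_inverse)
    moreover have "k w * exp (- (w * x\<^sup>2)) = indicator {0<..} w * (w powr (p - 1) * exp (- (w * (1 + x\<^sup>2))))" for w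
      by (simp add: k_def algebra_simps flip: exp_add)
    ultimately show ?thesis
      by simp
  qed
  \<comment> \<open>Integrability in \<open>x\<close> is a by-product of Fubini, taking the marginal
    of \<open>norm (F w x)\<close> in the other order; no tail estimate enters.\<close>
  have "integrable lborel (\<lambda>x. \<integral>w. norm (F w x) \<partial>lborel)"
    using lborel_pair.integrable_snd[of "\<lambda>w x. norm (F w x)"] integrable_norm[OF int]
    by (simp add: case_prod_unfold)
  then have "integrable lborel (\<lambda>x. Gamma p * (1 + x\<^sup>2) powr - p)"
    using mix by (simp add: norm_F has_bochner_integral_iff)
  then show "integrable lborel (\<lambda>x. (1 + x\<^sup>2) powr - (\<alpha> + 1 / 2))"
    using Gamma_real_pos[OF p] by (simp add: p_def)
  have inner: "(\<integral>x. F w x \<partial>lborel)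
      = of_real (sqrt pi * (indicator {0<..} w * (w powr (\<alpha> - 1) * exp (- w - s\<^sup>2 / (4 * w)))))" for w
  proof (cases "0 < w")
    case True
    have "(\<integral>x. F w x \<partial>lborel) = k w *\<^sub>R (\<integral>x. exp (- (w * x\<^sup>2)) *\<^sub>R iexp (s * x) \<partial>lborel)"
      by (simp add: F_def flip: integral_scaleR_right)
    then have F: "(\<integral>x. F w x \<partial>lborel) = of_real (k w * (sqrt (pi / w) * exp (- (s\<^sup>2 / (4 * w)))))"
      unfolding integral_gaussian_iexp[OF True] by (simp only: scaleR_conv_of_real of_real_mult)
    have "w powr (p - 1) = w powr (\<alpha> - 1) * sqrt w"
      using True by (simp add: p_def powr_half_sqrt[symmetric] flip: powr_add)
    moreover have "exp (- w) * exp (- (s\<^sup>2 / (4 * w))) = exp (- w - s\<^sup>2 / (4 * w))"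
      by (simp flip: exp_add)
    ultimately have "k w * (sqrt (pi / w) * exp (- (s\<^sup>2 / (4 * w))))
        = sqrt pi * (indicator {0<..} w * (w powr (\<alpha> - 1) * exp (- w - s\<^sup>2 / (4 * w))))"
      using True by (simp add: k_def real_sqrt_divide)
    then show ?thesis
      unfolding F by (rule arg_cong)
  qed (simp add: F_def k_def)
  have "(\<integral>w. F w x \<partial>lborel) = Gamma p * ((1 + x\<^sup>2) powr - p *\<^sub>R iexp (s * x))" for x
  proof -
    have "(\<integral>w. F w x \<partial>lborel) = (\<integral>w. k w * exp (- (w * x\<^sup>2)) \<partial>lborel) *\<^sub>R iexp (s * x)"
      unfolding F_def using mix[of x] by (intro integral_scaleR_left) (simp add: has_bochner_integral_iff)
    also have "(\<integral>w. k w * exp (- (w * x\<^sup>2)) \<partial>lborel) = Gamma p * (1 + x\<^sup>2) powr - p"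
      using mix by (rule has_bochner_integral_integral_eq)
    finally show ?thesis
      by (simp add: scaleR_conv_of_real)
  qed
  then have "Gamma p * (\<integral>x. (1 + x\<^sup>2) powr - p *\<^sub>R iexp (s * x) \<partial>lborel) = (\<integral>x. (\<integral>w. F w x \<partial>lborel) \<partial>lborel)"
    by (simp only: integral_mult_right_zero)
  also have "\<dots> = (\<integral>w. (\<integral>x. F w x \<partial>lborel) \<partial>lborel)"
    by (rule lborel_pair.Fubini_integral[OF int])
  also have "\<dots> = (\<integral>w. complex_of_real (sqrt pi * (indicator {0<..} w * (w powr (\<alpha> - 1) * exp (- w - s\<^sup>2 / (4 * w))))) \<partial>lborel)"
    by (simp only: inner)
  also have "(\<integral>w. complex_of_real (sqrt pi * (indicator {0<..} w * (w powr (\<alpha> - 1) * exp (- w - s\<^sup>2 / (4 * w))))) \<partial>lborel)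
      = of_real (sqrt pi * (\<integral>w. indicator {0<..} w * (w powr (\<alpha> - 1) * exp (- w - s\<^sup>2 / (4 * w))) \<partial>lborel))"
    by (simp only: integral_complex_of_real integral_mult_right_zero)
  finally show "of_real (Gamma (\<alpha> + 1 / 2)) * (\<integral>x. (1 + x\<^sup>2) powr - (\<alpha> + 1 / 2) *\<^sub>R iexp (s * x) \<partial>lborel)
       = of_real (sqrt pi * (\<integral>w. indicator {0<..} w * (w powr (\<alpha> - 1) * exp (- w - s\<^sup>2 / (4 * w))) \<partial>lborel))"
    by (simp only: p_def)
qed

text \<open>The exponent \<open>- w - s^2 / (4 * w)\<close> is invariant under exchanging
  \<open>w\<close> and \<open>s^2 / (4 * w)\<close>, with fixed point \<open>s / 2\<close>.
  Measuring \<open>w\<close> from there on a logarithmic scale makes this a reflection in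
  \<open>u\<close> and the exponent \<open>- s * cosh u\<close>. Folding the line at 0 then replaces
  \<open>exp (\<alpha> * u)\<close> by \<open>2 * cosh (\<alpha> * u)\<close>.\<close>

lemma integral_powr_exp_eq_Bessel_K:
  assumes "0 < \<alpha>" "0 < s"
  shows "(\<integral>w. indicator {0<..} w * (w powr (\<alpha> - 1) * exp (- w - s\<^sup>2 / (4 * w))) \<partial>lborel)
       = 2 * (s / 2) powr \<alpha> * Bessel_K \<alpha> s"
proof -
  define f where "f w = w powr (\<alpha> - 1) * exp (- w - s\<^sup>2 / (4 * w))" for w :: real
  define g where "g u = s / 2 * exp u" for u :: real
  define h where "h u = exp (\<alpha> * u) * exp (- s * cosh u)" for u :: real
  have "set_integrable lborel {0<..} f"
    unfolding set_integrable_def real_scaleR_def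
  proof (rule Bochner_Integration.integrable_bound)
    show "integrable lborel (\<lambda>w. indicator {0<..} w * (w powr (\<alpha> - 1) * exp (- (w * 1))))"
      using has_bochner_integral_Gamma[OF assms(1), of 1] by (simp add: has_bochner_integral_iff)
    show "(\<lambda>w. indicator {0<..} w * f w) \<in> borel_measurable lborel"
      unfolding f_def by measurable
    show "AE w in lborel. norm (indicator {0<..} w * f w)
        \<le> norm (indicator {0<..} w * (w powr (\<alpha> - 1) * exp (- (w * 1))))"
    proof (rule AE_I2)
      fix w :: real
      show "norm (indicator {0<..} w * f w) \<le> norm (indicator {0<..} w * (w powr (\<alpha> - 1) * exp (- (w * 1))))"
      proof (cases "0 < w")
        case True
        then have "exp (- w - s\<^sup>2 / (4 * w)) \<le> exp (- (w * 1))"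
          by simp
        then show ?thesis
          by (simp add: f_def abs_mult mult_left_mono)
      qed simp
    qed
  qed
  then have f_eq: "(LINT w:{0<..}|lborel. f w) = integral {0<..} f"
    and "f integrable_on {0<..}"
    by (rule set_borel_integral_eq_integral)+
  then have f: "f absolutely_integrable_on {0<..}"
    by (intro nonnegative_absolutely_integrable_1) (auto simp: f_def)
  have range_g: "range g = {0<..}"
  proof -
    have "w \<in> range g" if "0 < w" for w
      using that assms by (intro image_eqI[of _ _ "ln (2 * w / s)"]) (auto simp: g_def)
    then show ?thesis
      using assms by (auto simp: g_def)
  qed
  \<comment> \<open>\<open>g\<close> is its own derivative, so the Jacobian supplies the factor that
    raises the exponent from \<open>\<alpha> - 1\<close> to \<alpha>.\<close>
  have fg: "\<bar>g u\<bar> * f (g u) = (s / 2) powr \<alpha> * h u" for u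
  proof -
    have "\<bar>g u\<bar> * f (g u) = g u powr \<alpha> * exp (- g u - s\<^sup>2 / (4 * g u))"
      using assms by (simp add: f_def g_def powr_diff)
    also have "g u powr \<alpha> = (s / 2) powr \<alpha> * exp u powr \<alpha>"
      unfolding g_def by (rule powr_mult)
    also have "exp u powr \<alpha> = exp (\<alpha> * u)"
      by (simp add: exp_powr_real mult.commute)
    also have "- g u - s\<^sup>2 / (4 * g u) = - s * cosh u"
      using assms by (simp add: g_def cosh_def exp_minus power2_eq_square field_simps)
    finally show ?thesis
      by (simp add: h_def)
  qed
  have "(\<lambda>u. \<bar>g u\<bar> * f (g u)) absolutely_integrable_on UNIV
      \<and> integral UNIV (\<lambda>u. \<bar>g u\<bar> * f (g u)) = integral {0<..} f"
  proof (rule has_absolute_integral_change_of_variables_1'[where f = f and g = g and g' = g, THEN iffD2])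
    show "(g has_real_derivative g u) (at u within UNIV)" for u
      unfolding g_def by (auto intro!: derivative_eq_intros)
    show "inj g"
      using assms by (auto simp: g_def inj_on_def)
    show "f absolutely_integrable_on range g \<and> integral (range g) f = integral {0<..} f"
      using f unfolding range_g by simp
  qed simp
  then have h: "h absolutely_integrable_on UNIV" "integral {0<..} f = (s / 2) powr \<alpha> * integral UNIV h"
    using assms by (auto simp: fg set_integrable_def)
  have [measurable]: "h \<in> borel_measurable borel"
    unfolding h_def cosh_field_def by measurable
  \<comment> \<open>Absolute integrability refers to the completed measure; Borel measurability of
    \<open>h\<close> brings it back to \<open>lborel\<close>.\<close>
  have h_int: "integrable lborel h"
    using h(1) by (simp add: set_integrable_def integrable_completion)
  have "(\<integral>u. h u \<partial>lborel) = (\<integral>u. h u * indicator {0<..} u + h u * indicator {..0} u \<partial>lborel)"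
    by (intro Bochner_Integration.integral_cong) (auto simp: indicator_def)
  also have "\<dots> = (\<integral>u. h u * indicator {0<..} u \<partial>lborel) + (\<integral>u. h u * indicator {..0} u \<partial>lborel)"
    using h_int by (intro Bochner_Integration.integral_add integrable_real_mult_indicator) auto
  also have "(\<integral>u. h u * indicator {..0} u \<partial>lborel) = \<bar>-1\<bar> *\<^sub>R (\<integral>u. h (0 + (-1) * u) * indicator {..0} (0 + (-1) * u) \<partial>lborel)"
    by (rule lborel_integral_real_affine) simp
  also have "(\<integral>u. h (0 + (-1) * u) * indicator {..0} (0 + (-1) * u) \<partial>lborel) = (\<integral>u. h (- u) * indicator {0<..} u \<partial>lborel)"
  proof (rule integral_cong_AE)
    \<comment> \<open>Reflecting \<open>{..0}\<close> gives \<open>{0..}\<close>, which differs from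
      \<open>{0<..}\<close> only in the null set \<open>{0}\<close>.\<close>
    show "AE u in lborel. h (0 + (-1) * u) * indicator {..0} (0 + (-1) * u) = h (- u) * indicator {0<..} u"
      using AE_lborel_singleton[of 0] by eventually_elim (auto simp: indicator_def)
  qed measurable
  also have "(\<integral>u. h u * indicator {0<..} u \<partial>lborel) + \<bar>-1\<bar> *\<^sub>R (\<integral>u. h (- u) * indicator {0<..} u \<partial>lborel)
      = (\<integral>u. h u * indicator {0<..} u + h (- u) * indicator {0<..} u \<partial>lborel)"
    using h_int lborel_integrable_real_affine[OF h_int, of "-1" 0]
    by (subst Bochner_Integration.integral_add) (auto intro!: integrable_real_mult_indicator)
  also have "\<dots> = (\<integral>u. 2 * (indicator {0<..} u *\<^sub>R (exp (- s * cosh u) * cosh (\<alpha> * u))) \<partial>lborel)"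
  proof -
    have "h u + h (- u) = 2 * (exp (- s * cosh u) * cosh (\<alpha> * u))" for u
      by (simp add: h_def cosh_field_def[of "\<alpha> * u"] algebra_simps)
    then show ?thesis
      by (intro Bochner_Integration.integral_cong) (auto simp: indicator_def)
  qed
  also have "\<dots> = 2 * Bessel_K \<alpha> s"
    by (simp add: Bessel_K_def set_lebesgue_integral_def)
  finally have "integral UNIV h = 2 * Bessel_K \<alpha> s"
    using integral_lborel[OF h_int] by simp
  then show ?thesis
    using f_eq h(2) by (simp add: f_def set_lebesgue_integral_def)
qed

section \<open>Density and characteristic function of the Student law\<close>

definition student_pdf :: "real \<Rightarrow> real \<Rightarrow> real" where
  "student_pdf \<nu> x = Gamma ((\<nu> + 1) / 2) / (sqrt (\<nu> * pi) * Gamma (\<nu> / 2)) * (1 + x\<^sup>2 / \<nu>) powr (- (\<nu> + 1) / 2)"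

lemma Student_eq: "Student \<nu> = density lborel (\<lambda>x. ennreal (student_pdf \<nu> x))"
  by (simp add: Student_def student_pdf_def)

lemma borel_measurable_student_pdf [measurable]: "student_pdf \<nu> \<in> borel_measurable borel"
  unfolding student_pdf_def by measurable

lemma student_pdf_nonneg: "0 < \<nu> \<Longrightarrow> 0 \<le> student_pdf \<nu> x"
  by (auto simp: student_pdf_def intro!: mult_nonneg_nonneg divide_nonneg_nonneg less_imp_le[OF Gamma_real_pos])

text \<open>Rescaling by \<open>sqrt \<nu>\<close> brings the density to the form of
  \<open>fourier_one_plus_square_powr\<close> with \<open>\<alpha> = \<nu> / 2\<close>.\<close>

lemma student_pdf_sqrt_mult:
  assumes "0 < \<nu>"
  shows "student_pdf \<nu> (sqrt \<nu> * x)
       = Gamma (\<nu> / 2 + 1 / 2) / (sqrt (\<nu> * pi) * Gamma (\<nu> / 2)) * (1 + x\<^sup>2) powr - (\<nu> / 2 + 1 / 2)"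
proof -
  have eq: "- (\<nu> + 1) / 2 = - (\<nu> / 2 + 1 / 2)" "(\<nu> + 1) / 2 = \<nu> / 2 + 1 / 2"
    by simp_all
  show ?thesis
    using assms unfolding student_pdf_def eq by (simp add: power_mult_distrib)
qed

lemma integrable_student_pdf:
  assumes "0 < \<nu>"
  shows "integrable lborel (student_pdf \<nu>)"
proof -
  have "integrable lborel (\<lambda>x. student_pdf \<nu> (0 + sqrt \<nu> * x))"
    unfolding add_0 student_pdf_sqrt_mult[OF assms]
    using assms by (intro integrable_mult_right fourier_one_plus_square_powr) simp
  then show ?thesis
    using assms by (subst (asm) lborel_integrable_real_affine_iff) auto
qed

text \<open>Kept in mixture form because this is still valid at \<open>t = 0\<close>, where the
  integral is \<open>Gamma (\<nu> / 2)\<close>. The absolute value is harmless, as only the square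
  occurs, and prepares the positive argument of \<open>Bessel_K\<close>.\<close>

lemma char_Student_mixture:
  assumes "0 < \<nu>"
  shows "char (Student \<nu>) t = of_real ((\<integral>w. indicator {0<..} w
           * (w powr (\<nu> / 2 - 1) * exp (- w - (sqrt \<nu> * \<bar>t\<bar>)\<^sup>2 / (4 * w))) \<partial>lborel) / Gamma (\<nu> / 2))"
proof -
  define C where "C = Gamma (\<nu> / 2 + 1 / 2) / (sqrt (\<nu> * pi) * Gamma (\<nu> / 2))"
  define I where "I = (\<integral>w. indicator {0<..} w * (w powr (\<nu> / 2 - 1) * exp (- w - (sqrt \<nu> * \<bar>t\<bar>)\<^sup>2 / (4 * w))) \<partial>lborel)"
  have "char (Student \<nu>) t = (\<integral>x. student_pdf \<nu> x *\<^sub>R iexp (t * x) \<partial>lborel)"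
    using assms by (simp add: Student_eq char_density student_pdf_nonneg)
  also have "\<dots> = \<bar>sqrt \<nu>\<bar> *\<^sub>R (\<integral>x. student_pdf \<nu> (0 + sqrt \<nu> * x) *\<^sub>R iexp (t * (0 + sqrt \<nu> * x)) \<partial>lborel)"
    using assms by (intro lborel_integral_real_affine) simp
  also have "(\<lambda>x. student_pdf \<nu> (0 + sqrt \<nu> * x) *\<^sub>R iexp (t * (0 + sqrt \<nu> * x)))
      = (\<lambda>x. C *\<^sub>R ((1 + x\<^sup>2) powr - (\<nu> / 2 + 1 / 2) *\<^sub>R iexp (sqrt \<nu> * t * x)))"
    unfolding add_0 student_pdf_sqrt_mult[OF assms] C_def by (simp add: mult_ac)
  also have "\<bar>sqrt \<nu>\<bar> *\<^sub>R (\<integral>x. C *\<^sub>R ((1 + x\<^sup>2) powr - (\<nu> / 2 + 1 / 2) *\<^sub>R iexp (sqrt \<nu> * t * x)) \<partial>lborel)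
      = of_real (1 / (sqrt pi * Gamma (\<nu> / 2)))
        * (of_real (Gamma (\<nu> / 2 + 1 / 2)) * (\<integral>x. (1 + x\<^sup>2) powr - (\<nu> / 2 + 1 / 2) *\<^sub>R iexp (sqrt \<nu> * t * x) \<partial>lborel))"
    using assms by (simp add: C_def scaleR_conv_of_real real_sqrt_mult)
  also have "\<dots> = of_real (1 / (sqrt pi * Gamma (\<nu> / 2))) * of_real (sqrt pi * I)"
    using fourier_one_plus_square_powr(2)[of "\<nu> / 2" "sqrt \<nu> * t"] assms
    by (simp add: I_def power_mult_distrib)
  also have "\<dots> = of_real (I / Gamma (\<nu> / 2))"
    by simp
  finally show ?thesis
    by (simp only: I_def)
qed

text \<open>Not taken from \<open>char_zero\<close>, which presupposes a probability measure: that
  the Student density has mass one is deduced from this value.\<close>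

lemma char_Student_zero:
  assumes "0 < \<nu>"
  shows "char (Student \<nu>) 0 = 1"
proof -
  have "Gamma (\<nu> / 2) \<noteq> 0"
    using Gamma_real_pos[of "\<nu> / 2"] assms by linarith
  moreover have "(\<integral>w. indicator {0<..} w * (w powr (\<nu> / 2 - 1) * exp (- w)) \<partial>lborel) = Gamma (\<nu> / 2)"
    using has_bochner_integral_Gamma[of "\<nu> / 2" 1] assms by (simp add: has_bochner_integral_iff)
  ultimately show ?thesis
    using assms by (simp add: char_Student_mixture)
qed

lemma char_Student:
  assumes "0 < \<nu>" "t \<noteq> 0"
  shows "char (Student \<nu>) t = of_real ((sqrt \<nu> * \<bar>t\<bar>) powr (\<nu> / 2) * Bessel_K (\<nu> / 2) (sqrt \<nu> * \<bar>t\<bar>)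
           / (2 powr (\<nu> / 2 - 1) * Gamma (\<nu> / 2)))"
proof -
  have "2 * (sqrt \<nu> * \<bar>t\<bar> / 2) powr (\<nu> / 2) = (sqrt \<nu> * \<bar>t\<bar>) powr (\<nu> / 2) / 2 powr (\<nu> / 2 - 1)"
    by (simp add: powr_divide powr_diff)
  then show ?thesis
    using assms by (simp add: char_Student_mixture integral_powr_exp_eq_Bessel_K)
qed

lemma integral_student_pdf:
  assumes "0 < \<nu>"
  shows "(\<integral>x. student_pdf \<nu> x \<partial>lborel) = 1"
proof -
  have "char (Student \<nu>) 0 = of_real (\<integral>x. student_pdf \<nu> x \<partial>lborel)"
    using assms by (simp add: Student_eq char_density student_pdf_nonneg scaleR_conv_of_real)
  then show ?thesis
    using char_Student_zero[OF assms] by (metis of_real_eq_1_iff)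
qed

text \<open>Gives access to \<open>isCont_char\<close>, from which the limit at the origin in the
  theorem is obtained.\<close>

lemma real_distribution_Student:
  assumes "0 < \<nu>"
  shows "real_distribution (Student \<nu>)"
proof -
  have "(\<integral>\<^sup>+x. ennreal (student_pdf \<nu> x) \<partial>lborel) = 1"
    using assms by (simp add: nn_integral_eq_integral integrable_student_pdf student_pdf_nonneg integral_student_pdf)
  then have "prob_space (Student \<nu>)"
    by (intro prob_spaceI) (simp add: Student_eq emeasure_density)
  then show ?thesis
    by (simp add: real_distribution_def real_distribution_axioms_def Student_eq)
qed

subsection \<open>The Tsallis distribution\<close>

text \<open>The parameters are forced: matching exponents requires
  \<open>1 / (1 - q) = \<theta> - 1\<close>, and \<open>(1 - q) * x^2 / 2 = (x / a)^2\<close> fixes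
  \<open>a = sqrt (2 / (1 - q))\<close>.\<close>

lemma tqg_kernel_eq_beta_symmetric_pdf:
  assumes "q < 1"
  shows "tqg_kernel 0 1 q x
       = 2 * 4 powr ((2 - q) / (1 - q) - 1) * Beta ((2 - q) / (1 - q)) ((2 - q) / (1 - q))
         * beta_symmetric_pdf ((2 - q) / (1 - q)) (x / sqrt (2 / (1 - q)))"
proof -
  define \<theta> where "\<theta> = (2 - q) / (1 - q)"
  define y where "y = x / sqrt (2 / (1 - q))"
  have \<theta>: "1 / (1 - q) = \<theta> - 1" "0 < \<theta>"
    using assms by (auto simp: \<theta>_def field_simps)
  have y: "(1 - q) * (1 / 2) * ((x - 0) / 1)\<^sup>2 = y\<^sup>2"
    using assms by (simp add: y_def power_divide)
  \<comment> \<open>Off the open interval the positive part is 0 and \<open>0 powr _ = 0\<close>, so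
    the kernel carries its indicator implicitly.\<close>
  have "indicator {-1<..<1} y * (1 - y\<^sup>2) powr (\<theta> - 1) = max 0 (1 - y\<^sup>2) powr (\<theta> - 1)"
  proof (cases "\<bar>y\<bar> < 1")
    case True
    then have "0 < 1 - y\<^sup>2" "y \<in> {-1<..<1}"
      by (auto simp: abs_square_less_1)
    then show ?thesis
      by simp
  next
    case False
    then have "1 - y\<^sup>2 \<le> 0" "y \<notin> {-1<..<1}"
      using abs_square_less_1[of y] by auto
    then show ?thesis
      by (simp add: max_def)
  qed
  moreover have "0 < Beta \<theta> \<theta>"
    using \<theta> by (intro Beta_real_pos)
  ultimately show ?thesis
    unfolding tqg_kernel_def \<theta>_def[symmetric] y_def[symmetric] y \<theta> beta_symmetric_pdf_def by simp
qed

text \<open>Matching the exponent \<open>1 / (1 - q)\<close> with \<open>- (\<nu> + 1) / 2\<close>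
  determines \<nu>; then \<open>(q - 1) * x^2 / 2 = (x / b)^2 / \<nu>\<close> determines
  \<open>b = sqrt (2 / (3 - q))\<close>. The positive part is inactive here.\<close>

lemma tqg_kernel_eq_student_pdf:
  assumes "1 < q" "q < 3"
  defines "\<nu> \<equiv> (3 - q) / (q - 1)"
  shows "tqg_kernel 0 1 q x
       = sqrt (\<nu> * pi) * Gamma (\<nu> / 2) / Gamma ((\<nu> + 1) / 2) * student_pdf \<nu> (x / sqrt (2 / (3 - q)))"
proof -
  have \<nu>: "0 < \<nu>" "1 / (1 - q) = - (\<nu> + 1) / 2"
    using assms by (auto simp: field_simps)
  have eq: "1 - (1 - q) * (1 / 2) * ((x - 0) / 1)\<^sup>2 = 1 + (x / sqrt (2 / (3 - q)))\<^sup>2 / \<nu>"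
    using assms by (simp add: power_divide field_simps)
  have "0 \<le> 1 + (x / sqrt (2 / (3 - q)))\<^sup>2 / \<nu>"
    using \<nu> by (intro add_nonneg_nonneg divide_nonneg_nonneg) auto
  then have "max 0 (1 - (1 - q) * (1 / 2) * ((x - 0) / 1)\<^sup>2) = 1 + (x / sqrt (2 / (3 - q)))\<^sup>2 / \<nu>"
    unfolding eq by (rule max_absorb2)
  moreover have "Gamma (\<nu> / 2) \<noteq> 0" "Gamma ((\<nu> + 1) / 2) \<noteq> 0"
    using \<nu> by (auto intro!: less_imp_neq[symmetric] Gamma_real_pos)
  ultimately show ?thesis
    unfolding tqg_kernel_def student_pdf_def \<nu>(2) using \<nu> by (simp add: real_sqrt_mult)
qed

section \<open>Characteristic functions of the standard Tsallis law\<close>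

lemma char_TQG_standard_compact:
  assumes "q < 1"
  defines "\<theta> \<equiv> (2 - q) / (1 - q)"
  shows "char (TQG 0 1 q) t = char (density lborel (\<lambda>x. ennreal (beta_symmetric_pdf \<theta> x))) (sqrt (2 / (1 - q)) * t)"
proof -
  have \<theta>: "0 < \<theta>"
    using assms by (simp add: \<theta>_def)
  show ?thesis
  proof (rule char_TQG_standard_eq_scaled[where g = "beta_symmetric_pdf \<theta>"])
    show "tqg_kernel 0 1 q x
        = 2 * 4 powr (\<theta> - 1) * Beta \<theta> \<theta> * beta_symmetric_pdf \<theta> (x / sqrt (2 / (1 - q)))" for x
      unfolding \<theta>_def using assms(1) by (rule tqg_kernel_eq_beta_symmetric_pdf)
    show "2 * 4 powr (\<theta> - 1) * Beta \<theta> \<theta> \<noteq> 0"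
      using Beta_real_pos[OF \<theta> \<theta>] by simp
    show "(\<integral>x. beta_symmetric_pdf \<theta> x \<partial>lborel) = 1"
      using has_bochner_integral_beta_symmetric_pdf[OF \<theta>] by (rule has_bochner_integral_integral_eq)
  qed (use assms(1) \<theta> in \<open>auto simp: beta_symmetric_pdf_nonneg\<close>)
qed

lemma char_TQG_standard_heavy_tailed:
  assumes "1 < q" "q < 3"
  defines "\<nu> \<equiv> (3 - q) / (q - 1)"
  shows "char (TQG 0 1 q) t = char (Student \<nu>) (sqrt (2 / (3 - q)) * t)"
proof -
  have \<nu>: "0 < \<nu>"
    using assms by (simp add: \<nu>_def)
  then have pos: "0 < Gamma (\<nu> / 2)" "0 < Gamma ((\<nu> + 1) / 2)"
    by (auto intro!: Gamma_real_pos)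
  show ?thesis
    unfolding Student_eq
  proof (rule char_TQG_standard_eq_scaled[where g = "student_pdf \<nu>"])
    show "tqg_kernel 0 1 q x = sqrt (\<nu> * pi) * Gamma (\<nu> / 2) / Gamma ((\<nu> + 1) / 2)
        * student_pdf \<nu> (x / sqrt (2 / (3 - q)))" for x
      unfolding \<nu>_def using assms(1,2) by (rule tqg_kernel_eq_student_pdf)
    show "sqrt (\<nu> * pi) * Gamma (\<nu> / 2) / Gamma ((\<nu> + 1) / 2) \<noteq> 0"
      using pos \<nu> by (intro less_imp_neq[symmetric]) (simp only: divide_pos_pos mult_pos_pos real_sqrt_gt_zero pi_gt_zero)
  qed (use assms(1,2) \<nu> in \<open>auto simp: student_pdf_nonneg integral_student_pdf\<close>)
qed

lemma TQG_standard_one: "TQG 0 1 1 = std_normal_distribution"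
  by (simp add: TQG_def tqg_density_def)

theorem theorem1:
  fixes \<mu> \<sigma> q :: real
  assumes "\<sigma> > 0" and "q < 3"
  shows
    "(\<forall>t. char (TQG \<mu> \<sigma> q) t = exp (\<i> * complex_of_real (t * \<mu>)) * char (TQG 0 1 q) (\<sigma> * t))
   \<and> (q < 1 \<longrightarrow>
        (let a = sqrt (2 / (1 - q)); \<theta> = (2 - q) / (1 - q) in
         \<forall>t. char (TQG 0 1 q) t = complex_of_real (hyp0F1 (\<theta> + 1 / 2) (- (1 / 4) * (a * t)\<^sup>2))
           \<and> complex_of_real (hyp0F1 (\<theta> + 1 / 2) (- (1 / 4) * (a * t)\<^sup>2))
               = complex_of_real (2 powr (\<theta> - 1 / 2) * Gamma (\<theta> + 1 / 2)
                   * Bessel_J_scaled (\<theta> - 1 / 2) (a * t))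
           \<and> complex_of_real (2 powr (\<theta> - 1 / 2) * Gamma (\<theta> + 1 / 2)
                   * Bessel_J_scaled (\<theta> - 1 / 2) (a * t))
               = char (BetaSymmetric \<theta>) (a * t)))
   \<and> (q = 1 \<longrightarrow>
        (\<forall>t. char (TQG 0 1 q) t = complex_of_real (exp (- (t\<^sup>2 / 2)))
           \<and> complex_of_real (exp (- (t\<^sup>2 / 2))) = char std_normal_distribution t))
   \<and> (1 < q \<longrightarrow>
        (let b = sqrt (2 / (3 - q)); \<nu> = (3 - q) / (q - 1);
             \<phi> = (\<lambda>t. (b * sqrt \<nu> * \<bar>t\<bar>) powr (\<nu> / 2) * Bessel_K (\<nu> / 2) (b * sqrt \<nu> * \<bar>t\<bar>)
                       / (2 powr (\<nu> / 2 - 1) * Gamma (\<nu> / 2))) in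
         \<nu> > 0 \<and> (\<phi> \<longlongrightarrow> 1) (at 0)
         \<and> (\<forall>t. char (TQG 0 1 q) t = complex_of_real (if t = 0 then 1 else \<phi> t)
              \<and> complex_of_real (if t = 0 then 1 else \<phi> t) = char (Student \<nu>) (b * t))))"
proof (intro conjI impI)
  show "\<forall>t. char (TQG \<mu> \<sigma> q) t = exp (\<i> * complex_of_real (t * \<mu>)) * char (TQG 0 1 q) (\<sigma> * t)"
    using char_TQG_location_scale[OF assms(1)] by blast
next
  assume q: "q < 1"
  define a where "a = sqrt (2 / (1 - q))"
  define \<theta> where "\<theta> = (2 - q) / (1 - q)"
  have "0 < \<theta>"
    using q by (simp add: \<theta>_def)
  then show "let a = sqrt (2 / (1 - q)); \<theta> = (2 - q) / (1 - q) in
         \<forall>t. char (TQG 0 1 q) t = complex_of_real (hyp0F1 (\<theta> + 1 / 2) (- (1 / 4) * (a * t)\<^sup>2))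
           \<and> complex_of_real (hyp0F1 (\<theta> + 1 / 2) (- (1 / 4) * (a * t)\<^sup>2))
               = complex_of_real (2 powr (\<theta> - 1 / 2) * Gamma (\<theta> + 1 / 2)
                   * Bessel_J_scaled (\<theta> - 1 / 2) (a * t))
           \<and> complex_of_real (2 powr (\<theta> - 1 / 2) * Gamma (\<theta> + 1 / 2)
                   * Bessel_J_scaled (\<theta> - 1 / 2) (a * t))
               = char (BetaSymmetric \<theta>) (a * t)"
    \<comment> \<open>All the expressions in the chain reduce to the same \<open>hyp0F1\<close> term
      at \<open>a * t\<close>.\<close>
    unfolding Let_def char_TQG_standard_compact[OF q] a_def[symmetric] \<theta>_def[symmetric]
    by (simp only: Bessel_J_scaled_eq_hyp0F1 char_BetaSymmetric_eq char_beta_symmetric_pdf simp_thms)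
next
  assume "q = 1"
  then show "\<forall>t. char (TQG 0 1 q) t = complex_of_real (exp (- (t\<^sup>2 / 2)))
      \<and> complex_of_real (exp (- (t\<^sup>2 / 2))) = char std_normal_distribution t"
    by (simp add: TQG_standard_one char_std_normal_distribution)
next
  assume q: "1 < q"
  define b where "b = sqrt (2 / (3 - q))"
  define \<nu> where "\<nu> = (3 - q) / (q - 1)"
  define \<phi> where "\<phi> t = (b * sqrt \<nu> * \<bar>t\<bar>) powr (\<nu> / 2) * Bessel_K (\<nu> / 2) (b * sqrt \<nu> * \<bar>t\<bar>)
      / (2 powr (\<nu> / 2 - 1) * Gamma (\<nu> / 2))" for t
  have \<nu>: "0 < \<nu>" and b: "0 < b"
    using q assms by (simp_all add: \<nu>_def b_def)
  interpret real_distribution "Student \<nu>"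
    using \<nu> by (rule real_distribution_Student)
  \<comment> \<open>\<open>\<phi> 0\<close> itself evaluates to 0, since
    \<open>0 powr _ = 0\<close>; the value at the origin therefore has to be given by cases.\<close>
  have char_eq: "char (Student \<nu>) (b * t) = complex_of_real (if t = 0 then 1 else \<phi> t)" for t
  proof (cases "t = 0")
    case False
    have eq: "sqrt \<nu> * \<bar>b * t\<bar> = b * sqrt \<nu> * \<bar>t\<bar>"
      using b by (simp add: abs_mult)
    show ?thesis
      using char_Student[OF \<nu>, of "b * t"] False b unfolding eq \<phi>_def by simp
  qed (simp add: char_zero)
  \<comment> \<open>The limit of \<phi> at 0 is read off from a continuous function with which
    \<phi> agrees away from 0, instead of from the behaviour of \<open>Bessel_K\<close> near
    0.\<close>
  have "isCont (\<lambda>t. Re (char (Student \<nu>) (b * t))) 0"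
    by (intro isCont_Re isCont_o2[OF _ isCont_char] continuous_intros)
  then have "((\<lambda>t. Re (char (Student \<nu>) (b * t))) \<longlongrightarrow> 1) (at 0)"
    by (simp add: isCont_def char_zero)
  moreover have "eventually (\<lambda>t. Re (char (Student \<nu>) (b * t)) = \<phi> t) (at 0)"
    unfolding char_eq by (intro eventually_at_filter[THEN iffD2] always_eventually) simp
  ultimately have "(\<phi> \<longlongrightarrow> 1) (at 0)"
    by (rule Lim_transform_eventually)
  moreover have "char (TQG 0 1 q) t = char (Student \<nu>) (b * t)" for t
    unfolding b_def \<nu>_def using q assms by (intro char_TQG_standard_heavy_tailed)
  ultimately have "0 < \<nu> \<and> (\<phi> \<longlongrightarrow> 1) (at 0)
      \<and> (\<forall>t. char (TQG 0 1 q) t = complex_of_real (if t = 0 then 1 else \<phi> t)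
           \<and> complex_of_real (if t = 0 then 1 else \<phi> t) = char (Student \<nu>) (b * t))"
    using \<nu> char_eq by simp
  then show "let b = sqrt (2 / (3 - q)); \<nu> = (3 - q) / (q - 1);
             \<phi> = (\<lambda>t. (b * sqrt \<nu> * \<bar>t\<bar>) powr (\<nu> / 2) * Bessel_K (\<nu> / 2) (b * sqrt \<nu> * \<bar>t\<bar>)
                       / (2 powr (\<nu> / 2 - 1) * Gamma (\<nu> / 2))) in
         \<nu> > 0 \<and> (\<phi> \<longlongrightarrow> 1) (at 0)
         \<and> (\<forall>t. char (TQG 0 1 q) t = complex_of_real (if t = 0 then 1 else \<phi> t)
              \<and> complex_of_real (if t = 0 then 1 else \<phi> t) = char (Student \<nu>) (b * t))"
    unfolding Let_def b_def[symmetric] \<nu>_def[symmetric] \<phi>_def[abs_def] .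
qed

end
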